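(* For every positive integer $n\ge2$ and every finite-dimensional subspace $G$ of $L_{2}([-\pi,\pi];\mathbb{K})$, there exists a (continuous) $n$-homogeneous polynomial $Q$ from $L_{2}([-\pi,\pi];\mathbb{K})$ to $L_{1}([-\pi,\pi];\mathbb{K})$ such that $S_{1}(Q)=G$.
   Context: $\mathbb{K}=\mathbb{R}$ or $\mathbb{C}$; $L_2$ and $L_1$ are taken with respect to Lebesgue measure on $[-\pi,\pi]$. For Banach spaces $E,F$ over $\mathbb{K}$: $\ell_1(F)$ is the space of sequences $(y_j)_{j=1}^\infty$ in $F$ with $\sum_j\|y_j\|<\infty$. $\ell_1^{w}(E)$ is the space of sequences $(x_j)_{j=1}^\infty$ in $E$ with $(\varphi(x_j))_j\in\ell_1$ for all $\varphi\in E'$ (the dual of $E$), normed by $\|(x_j)_j\|_{w,1}=\sup\{\sum_j|\varphi(x_j)|:\varphi\in E',\|\varphi\|\le1\}$. $\ell_1^{u}(E)$ (unconditionally summable sequences) is the subspace of those $(x_j)_j\in\ell_1^w(E)$ with $\lim_{k\to\infty}\|(x_j)_{j=k}^\infty\|_{w,1}=0$. A mapping $f\colon E\to F$ is $1$-summing at $a\in E$ if $(f(a+x_j)-f(a))_{j=1}^\infty\in\ell_1(F)$ whenever $(x_j)_{j=1}^\infty\in\ell_1^u(E)$. The $1$-summing set of $f$ is $S_{1}(f)=\{a\in E: f\text{ is }1\text{-summing at }a\}$. *)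

theory Defs
  imports "HOL-Analysis.Analysis"
begin

text \<open>
  The scalar field is a type of sort \<open>{real_normed_field, euclidean_space}\<close>; it is used
  below at \<^typ>\<open>real\<close> and \<^typ>\<open>complex\<close>.  A normed space over the scalars is a
  \<open>real_normed_vector\<close> together with an explicit scalar multiplication, since the type class only
  provides multiplication by real numbers.
\<close>

section \<open>Square-integrable and integrable functions on the interval from \<open>-\<pi>\<close> to \<open>\<pi>\<close>\<close>

abbreviation Leb :: "real measure"
  where "Leb \<equiv> lebesgue_on {- pi..pi}"

definition sq_integrable :: "(real \<Rightarrow> 'k::{real_normed_field, euclidean_space}) \<Rightarrow> bool"
  where "sq_integrable f \<longleftrightarrow>
    f \<in> borel_measurable Leb \<and> integrable Leb (\<lambda>t. (norm (f t))\<^sup>2)"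

lemma sq_integrable_mult:
  assumes "sq_integrable f" "sq_integrable g"
  shows "integrable Leb (\<lambda>t. norm (f t) * norm (g t))"
proof (rule Bochner_Integration.integrable_bound)
  show "integrable Leb (\<lambda>t. (norm (f t))\<^sup>2 + (norm (g t))\<^sup>2)"
    using assms by (auto simp: sq_integrable_def)
  show "(\<lambda>t. norm (f t) * norm (g t)) \<in> borel_measurable Leb"
    using assms by (auto simp: sq_integrable_def)
  have "norm a * norm b \<le> (norm a)\<^sup>2 + (norm b)\<^sup>2" for a :: 'a and b :: 'b
    using sum_squares_bound[of "norm a" "norm b"]
      mult_nonneg_nonneg[OF norm_ge_zero[of a] norm_ge_zero[of b]]
    unfolding mult.assoc by linarith
  then show "AE t in Leb. norm (norm (f t) * norm (g t)) \<le>
      norm ((norm (f t))\<^sup>2 + (norm (g t))\<^sup>2)"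
    by simp
qed

lemma sq_integrable_add:
  assumes "sq_integrable f" "sq_integrable g"
  shows "sq_integrable (\<lambda>t. f t + g t)"
proof -
  have "integrable Leb (\<lambda>t. (norm (f t + g t))\<^sup>2)"
  proof (rule Bochner_Integration.integrable_bound)
    show "integrable Leb (\<lambda>t. (norm (f t))\<^sup>2 + 2 * (norm (f t) * norm (g t)) + (norm (g t))\<^sup>2)"
      using assms sq_integrable_mult[OF assms] by (auto simp: sq_integrable_def)
    show "(\<lambda>t. (norm (f t + g t))\<^sup>2) \<in> borel_measurable Leb"
      using assms by (auto simp: sq_integrable_def)
    have "(norm (a + b))\<^sup>2 \<le> (norm a)\<^sup>2 + 2 * (norm a * norm b) + (norm b)\<^sup>2" for a b :: 'a
      using power_mono[OF norm_triangle_ineq[of a b], of 2]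
      by (simp add: power2_sum algebra_simps)
    then show "AE t in Leb. norm ((norm (f t + g t))\<^sup>2) \<le>
        norm ((norm (f t))\<^sup>2 + 2 * (norm (f t) * norm (g t)) + (norm (g t))\<^sup>2)"
      by simp
  qed
  then show ?thesis
    using assms by (auto simp: sq_integrable_def)
qed

lemma sq_integrable_mult_const:
  "sq_integrable f \<Longrightarrow> sq_integrable (\<lambda>t. c * f t)"
  by (auto simp: sq_integrable_def norm_mult power_mult_distrib)

lemma sq_integrable_scaleR:
  "sq_integrable f \<Longrightarrow> sq_integrable (\<lambda>t. c *\<^sub>R f t)"
  by (auto simp: sq_integrable_def power_mult_distrib)

lemma sq_integrable_minus:
  "sq_integrable f \<Longrightarrow> sq_integrable (\<lambda>t. - f t)"
  by (auto simp: sq_integrable_def)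

lemma sq_integrable_zero: "sq_integrable (\<lambda>t. 0)"
  by (auto simp: sq_integrable_def)

lemma sq_integrable_norm_eq_0:
  assumes "sq_integrable f"
  shows "(\<integral>t. (norm (f t))\<^sup>2 \<partial>Leb) = 0 \<longleftrightarrow> (AE t in Leb. f t = 0)"
  using assms integral_nonneg_eq_0_iff_AE[of Leb "\<lambda>t. (norm (f t))\<^sup>2"]
  by (auto simp: sq_integrable_def)

lemma sq_integrable_Cauchy_Schwarz:
  assumes f: "sq_integrable f" and g: "sq_integrable g"
  shows "(\<integral>t. norm (f t) * norm (g t) \<partial>Leb) \<le>
    sqrt (\<integral>t. (norm (f t))\<^sup>2 \<partial>Leb) * sqrt (\<integral>t. (norm (g t))\<^sup>2 \<partial>Leb)"
proof -
  define a where "a = sqrt (\<integral>t. (norm (f t))\<^sup>2 \<partial>Leb)"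
  define b where "b = sqrt (\<integral>t. (norm (g t))\<^sup>2 \<partial>Leb)"
  have a2: "a\<^sup>2 = (\<integral>t. (norm (f t))\<^sup>2 \<partial>Leb)" and b2: "b\<^sup>2 = (\<integral>t. (norm (g t))\<^sup>2 \<partial>Leb)"
    by (simp_all add: a_def b_def)
  have nn: "a \<ge> 0" "b \<ge> 0"
    by (simp_all add: a_def b_def)
  show ?thesis
  proof (cases "a = 0 \<or> b = 0")
    case True
    then have "(AE t in Leb. f t = 0) \<or> (AE t in Leb. g t = 0)"
      using sq_integrable_norm_eq_0[OF f] sq_integrable_norm_eq_0[OF g] a2 b2 by auto
    then have "AE t in Leb. norm (f t) * norm (g t) = 0"
      by (auto elim: AE_mp)
    then have "(\<integral>t. norm (f t) * norm (g t) \<partial>Leb) = 0"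
      by (rule integral_eq_zero_AE)
    then show ?thesis
      by simp
  next
    case False
    with nn have pos: "a > 0" "b > 0"
      by auto
    have bound: "2 * (x * y) \<le> (b / a) * x\<^sup>2 + (a / b) * y\<^sup>2" for x y :: real
    proof -
      have "0 \<le> (b * x - a * y)\<^sup>2 / (a * b)"
        using pos by simp
      also have "\<dots> = (b / a) * x\<^sup>2 + (a / b) * y\<^sup>2 - 2 * (x * y)"
        using pos by (simp add: field_simps power2_eq_square)
      finally show ?thesis
        by simp
    qed
    have "(\<integral>t. 2 * (norm (f t) * norm (g t)) \<partial>Leb) \<le>
        (\<integral>t. (b / a) * (norm (f t))\<^sup>2 + (a / b) * (norm (g t))\<^sup>2 \<partial>Leb)"
      using f g sq_integrable_mult[OF f g] bound
      by (intro integral_mono) (auto simp: sq_integrable_def)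
    also have "\<dots> = (b / a) * a\<^sup>2 + (a / b) * b\<^sup>2"
      using f g unfolding a2 b2 sq_integrable_def by simp
    also have "\<dots> = 2 * (a * b)"
      using pos by (simp add: power2_eq_square)
    finally show ?thesis
      by (simp add: a_def b_def)
  qed
qed

lemma sq_integrable_Minkowski:
  assumes f: "sq_integrable f" and g: "sq_integrable g"
  shows "sqrt (\<integral>t. (norm (f t + g t))\<^sup>2 \<partial>Leb) \<le>
    sqrt (\<integral>t. (norm (f t))\<^sup>2 \<partial>Leb) + sqrt (\<integral>t. (norm (g t))\<^sup>2 \<partial>Leb)"
    (is "_ \<le> sqrt ?A + sqrt ?B")
proof (rule real_le_lsqrt)
  have nn: "?A \<ge> 0" "?B \<ge> 0"
    by simp_all
  then show "0 \<le> sqrt ?A + sqrt ?B"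
    by simp
  have "(norm (a + b))\<^sup>2 \<le> (norm a)\<^sup>2 + 2 * (norm a * norm b) + (norm b)\<^sup>2" for a b :: 'a
    using power_mono[OF norm_triangle_ineq[of a b], of 2]
    by (simp add: power2_sum algebra_simps)
  then have "(\<integral>t. (norm (f t + g t))\<^sup>2 \<partial>Leb) \<le>
      (\<integral>t. (norm (f t))\<^sup>2 + 2 * (norm (f t) * norm (g t)) + (norm (g t))\<^sup>2 \<partial>Leb)"
    using f g sq_integrable_mult[OF f g] sq_integrable_add[OF f g]
    by (intro integral_mono) (auto simp: sq_integrable_def)
  also have "\<dots> = ?A + 2 * (\<integral>t. norm (f t) * norm (g t) \<partial>Leb) + ?B"
    using f g sq_integrable_mult[OF f g] by (simp add: sq_integrable_def)
  also have "\<dots> \<le> ?A + 2 * (sqrt ?A * sqrt ?B) + ?B"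
    using sq_integrable_Cauchy_Schwarz[OF f g] by simp
  also have "\<dots> = (sqrt ?A + sqrt ?B)\<^sup>2"
    using nn by (simp add: power2_sum)
  finally show "(\<integral>t. (norm (f t + g t))\<^sup>2 \<partial>Leb) \<le> (sqrt ?A + sqrt ?B)\<^sup>2" .
qed

section \<open>The spaces \<open>L\<^sub>2\<close> and \<open>L\<^sub>1\<close>\<close>

definition L2_rel ::
    "(real \<Rightarrow> 'k::{real_normed_field, euclidean_space}) \<Rightarrow> (real \<Rightarrow> 'k) \<Rightarrow> bool"
  where "L2_rel f g \<longleftrightarrow> sq_integrable f \<and> sq_integrable g \<and> (AE t in Leb. f t = g t)"

definition L1_rel ::
    "(real \<Rightarrow> 'k::{real_normed_field, euclidean_space}) \<Rightarrow> (real \<Rightarrow> 'k) \<Rightarrow> bool"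
  where "L1_rel f g \<longleftrightarrow> integrable Leb f \<and> integrable Leb g \<and> (AE t in Leb. f t = g t)"

quotient_type (overloaded) 'k L2 =
  "real \<Rightarrow> 'k::{real_normed_field, euclidean_space}" / partial: L2_rel
proof (rule part_equivpI)
  show "\<exists>f::real \<Rightarrow> 'k. L2_rel f f"
    using sq_integrable_zero by (auto simp: L2_rel_def)
  show "symp (L2_rel :: (real \<Rightarrow> 'k) \<Rightarrow> _)"
    by (auto simp: symp_def L2_rel_def elim: AE_mp)
  show "transp (L2_rel :: (real \<Rightarrow> 'k) \<Rightarrow> _)"
    unfolding transp_def L2_rel_def by (auto elim: AE_mp)
qed

quotient_type (overloaded) 'k L1 =
  "real \<Rightarrow> 'k::{real_normed_field, euclidean_space}" / partial: L1_rel
proof (rule part_equivpI)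
  show "\<exists>f::real \<Rightarrow> 'k. L1_rel f f"
    by (rule exI[of _ "\<lambda>t. 0"]) (auto simp: L1_rel_def)
  show "symp (L1_rel :: (real \<Rightarrow> 'k) \<Rightarrow> _)"
    by (auto simp: symp_def L1_rel_def elim: AE_mp)
  show "transp (L1_rel :: (real \<Rightarrow> 'k) \<Rightarrow> _)"
    unfolding transp_def L1_rel_def by (auto elim: AE_mp)
qed

instantiation L2 :: ("{real_normed_field, euclidean_space}") real_vector
begin

lift_definition zero_L2 :: "'a L2" is "\<lambda>t. 0"
  by (auto simp: L2_rel_def sq_integrable_zero)

lift_definition plus_L2 :: "'a L2 \<Rightarrow> 'a L2 \<Rightarrow> 'a L2" is "\<lambda>f g t. f t + g t"
  unfolding L2_rel_def by (auto simp: sq_integrable_add)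

lift_definition uminus_L2 :: "'a L2 \<Rightarrow> 'a L2" is "\<lambda>f t. - f t"
  unfolding L2_rel_def by (auto simp: sq_integrable_minus)

definition minus_L2 :: "'a L2 \<Rightarrow> 'a L2 \<Rightarrow> 'a L2"
  where "minus_L2 f g = f + - g"

lift_definition scaleR_L2 :: "real \<Rightarrow> 'a L2 \<Rightarrow> 'a L2" is "\<lambda>c f t. c *\<^sub>R f t"
  unfolding L2_rel_def by (auto simp: sq_integrable_scaleR)

instance
proof
  fix f g h :: "'a L2" and c d :: real
  show "f + g + h = f + (g + h)"
    by transfer (auto simp: L2_rel_def sq_integrable_add add.assoc)
  show "f + g = g + f"
    by transfer (auto simp: L2_rel_def sq_integrable_add add.commute)
  show "0 + f = f"
    by transfer (auto simp: L2_rel_def)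
  show "- f + f = 0"
    by transfer (auto simp: L2_rel_def sq_integrable_zero)
  show "f - g = f + - g"
    by (simp add: minus_L2_def)
  show "c *\<^sub>R (f + g) = c *\<^sub>R f + c *\<^sub>R g"
    by transfer (auto simp: L2_rel_def sq_integrable_add sq_integrable_scaleR scaleR_add_right)
  show "(c + d) *\<^sub>R f = c *\<^sub>R f + d *\<^sub>R f"
    by transfer (auto simp: L2_rel_def sq_integrable_add sq_integrable_scaleR scaleR_add_left)
  show "c *\<^sub>R d *\<^sub>R f = (c * d) *\<^sub>R f"
    by transfer (auto simp: L2_rel_def sq_integrable_scaleR)
  show "1 *\<^sub>R f = f"
    by transfer (auto simp: L2_rel_def)
qed

end

instantiation L1 :: ("{real_normed_field, euclidean_space}") real_vector
begin

lift_definition zero_L1 :: "'a L1" is "\<lambda>t. 0"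
  by (auto simp: L1_rel_def)

lift_definition plus_L1 :: "'a L1 \<Rightarrow> 'a L1 \<Rightarrow> 'a L1" is "\<lambda>f g t. f t + g t"
  unfolding L1_rel_def by auto

lift_definition uminus_L1 :: "'a L1 \<Rightarrow> 'a L1" is "\<lambda>f t. - f t"
  unfolding L1_rel_def by auto

definition minus_L1 :: "'a L1 \<Rightarrow> 'a L1 \<Rightarrow> 'a L1"
  where "minus_L1 f g = f + - g"

lift_definition scaleR_L1 :: "real \<Rightarrow> 'a L1 \<Rightarrow> 'a L1" is "\<lambda>c f t. c *\<^sub>R f t"
  unfolding L1_rel_def by auto

instance
proof
  fix f g h :: "'a L1" and c d :: real
  show "f + g + h = f + (g + h)"
    by transfer (auto simp: L1_rel_def add.assoc)
  show "f + g = g + f"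
    by transfer (auto simp: L1_rel_def add.commute)
  show "0 + f = f"
    by transfer (auto simp: L1_rel_def)
  show "- f + f = 0"
    by transfer (auto simp: L1_rel_def)
  show "f - g = f + - g"
    by (simp add: minus_L1_def)
  show "c *\<^sub>R (f + g) = c *\<^sub>R f + c *\<^sub>R g"
    by transfer (auto simp: L1_rel_def scaleR_add_right)
  show "(c + d) *\<^sub>R f = c *\<^sub>R f + d *\<^sub>R f"
    by transfer (auto simp: L1_rel_def scaleR_add_left)
  show "c *\<^sub>R d *\<^sub>R f = (c * d) *\<^sub>R f"
    by transfer (auto simp: L1_rel_def)
  show "1 *\<^sub>R f = f"
    by transfer (auto simp: L1_rel_def)
qed

end

instantiation L2 :: ("{real_normed_field, euclidean_space}") real_normed_vector
begin

lift_definition norm_L2 :: "'a L2 \<Rightarrow> real"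
  is "\<lambda>f. sqrt (\<integral>t. (norm (f t))\<^sup>2 \<partial>Leb)"
proof -
  fix f g :: "real \<Rightarrow> 'a"
  assume *: "L2_rel f g"
  have "(\<integral>t. (norm (f t))\<^sup>2 \<partial>Leb) = (\<integral>t. (norm (g t))\<^sup>2 \<partial>Leb)"
    using * by (intro integral_cong_AE) (auto simp: L2_rel_def sq_integrable_def)
  then show "sqrt (\<integral>t. (norm (f t))\<^sup>2 \<partial>Leb) = sqrt (\<integral>t. (norm (g t))\<^sup>2 \<partial>Leb)"
    by simp
qed

definition sgn_L2 :: "'a L2 \<Rightarrow> 'a L2"
  where "sgn_L2 f = f /\<^sub>R norm f"

definition dist_L2 :: "'a L2 \<Rightarrow> 'a L2 \<Rightarrow> real"
  where "dist_L2 f g = norm (f - g)"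

definition uniformity_L2 :: "('a L2 \<times> 'a L2) filter"
  where "uniformity_L2 = (INF e\<in>{0<..}. principal {(f, g). dist f g < e})"

definition open_L2 :: "'a L2 set \<Rightarrow> bool"
  where "open_L2 U \<longleftrightarrow> (\<forall>f\<in>U. eventually (\<lambda>(f', g). f' = f \<longrightarrow> g \<in> U) uniformity)"

instance
proof
  fix f g :: "'a L2" and c :: real and U :: "'a L2 set"
  show "dist f g = norm (f - g)"
    by (rule dist_L2_def)
  show "sgn f = f /\<^sub>R norm f"
    by (rule sgn_L2_def)
  show "uniformity = (INF e\<in>{0<..}. principal {(f::'a L2, g). dist f g < e})"
    by (rule uniformity_L2_def)
  show "open U \<longleftrightarrow> (\<forall>f\<in>U. eventually (\<lambda>(f', g). f' = f \<longrightarrow> g \<in> U) uniformity)"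
    by (rule open_L2_def)
  show "norm f = 0 \<longleftrightarrow> f = 0"
    by transfer (auto simp: L2_rel_def sq_integrable_zero sq_integrable_norm_eq_0)
  show "norm (f + g) \<le> norm f + norm g"
    by transfer (auto simp: L2_rel_def sq_integrable_Minkowski)
  show "norm (c *\<^sub>R f) = \<bar>c\<bar> * norm f"
    by transfer (simp add: power_mult_distrib real_sqrt_mult)
qed

end

instantiation L1 :: ("{real_normed_field, euclidean_space}") real_normed_vector
begin

lift_definition norm_L1 :: "'a L1 \<Rightarrow> real"
  is "\<lambda>f. \<integral>t. norm (f t) \<partial>Leb"
  by (intro integral_cong_AE) (auto simp: L1_rel_def)

definition sgn_L1 :: "'a L1 \<Rightarrow> 'a L1"
  where "sgn_L1 f = f /\<^sub>R norm f"

definition dist_L1 :: "'a L1 \<Rightarrow> 'a L1 \<Rightarrow> real"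
  where "dist_L1 f g = norm (f - g)"

definition uniformity_L1 :: "('a L1 \<times> 'a L1) filter"
  where "uniformity_L1 = (INF e\<in>{0<..}. principal {(f, g). dist f g < e})"

definition open_L1 :: "'a L1 set \<Rightarrow> bool"
  where "open_L1 U \<longleftrightarrow> (\<forall>f\<in>U. eventually (\<lambda>(f', g). f' = f \<longrightarrow> g \<in> U) uniformity)"

instance
proof
  fix f g :: "'a L1" and c :: real and U :: "'a L1 set"
  show "dist f g = norm (f - g)"
    by (rule dist_L1_def)
  show "sgn f = f /\<^sub>R norm f"
    by (rule sgn_L1_def)
  show "uniformity = (INF e\<in>{0<..}. principal {(f::'a L1, g). dist f g < e})"
    by (rule uniformity_L1_def)
  show "open U \<longleftrightarrow> (\<forall>f\<in>U. eventually (\<lambda>(f', g). f' = f \<longrightarrow> g \<in> U) uniformity)"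
    by (rule open_L1_def)
  show "norm f = 0 \<longleftrightarrow> f = 0"
  proof (transfer, unfold L1_rel_def)
    fix f :: "real \<Rightarrow> 'a"
    assume "integrable Leb f \<and> integrable Leb f \<and> (AE t in Leb. f t = f t)"
    then show "(\<integral>t. norm (f t) \<partial>Leb) = 0 \<longleftrightarrow>
        integrable Leb f \<and> integrable Leb (\<lambda>t. 0::'a) \<and> (AE t in Leb. f t = 0)"
      using integral_nonneg_eq_0_iff_AE[of Leb "\<lambda>t. norm (f t)"] by auto
  qed
  show "norm (f + g) \<le> norm f + norm g"
  proof (transfer, unfold L1_rel_def)
    fix f g :: "real \<Rightarrow> 'a"
    assume *: "integrable Leb f \<and> integrable Leb f \<and> (AE t in Leb. f t = f t)"
      "integrable Leb g \<and> integrable Leb g \<and> (AE t in Leb. g t = g t)"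
    then have "(\<integral>t. norm (f t + g t) \<partial>Leb) \<le> (\<integral>t. norm (f t) + norm (g t) \<partial>Leb)"
      by (intro integral_mono) (auto intro: norm_triangle_ineq)
    with * show "(\<integral>t. norm (f t + g t) \<partial>Leb) \<le>
        (\<integral>t. norm (f t) \<partial>Leb) + (\<integral>t. norm (g t) \<partial>Leb)"
      by simp
  qed
  show "norm (c *\<^sub>R f) = \<bar>c\<bar> * norm f"
    by transfer simp
qed

end

lift_definition scaleL2 :: "'k \<Rightarrow> 'k L2 \<Rightarrow> 'k::{real_normed_field, euclidean_space} L2"
  is "\<lambda>c f t. c * f t"
  unfolding L2_rel_def by (auto simp: sq_integrable_mult_const)

lift_definition scaleL1 :: "'k \<Rightarrow> 'k L1 \<Rightarrow> 'k::{real_normed_field, euclidean_space} L1"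
  is "\<lambda>c f t. c * f t"
  unfolding L1_rel_def by auto

lemma scaleL2_of_real: "scaleL2 (of_real r) f = r *\<^sub>R f"
  by transfer (auto simp: L2_rel_def sq_integrable_scaleR scaleR_conv_of_real
      sq_integrable_mult_const)

lemma scaleL1_of_real: "scaleL1 (of_real r) f = r *\<^sub>R f"
  by transfer (auto simp: L1_rel_def scaleR_conv_of_real)

lemma norm_scaleL2: "norm (scaleL2 c f) = norm c * norm f"
  by transfer (simp add: norm_mult power_mult_distrib real_sqrt_mult)

lemma norm_scaleL1: "norm (scaleL1 c f) = norm c * norm f"
  by transfer (simp add: norm_mult)

lemma vector_space_scaleL2:
  "vector_space (scaleL2 :: 'k::{real_normed_field, euclidean_space} \<Rightarrow> _)"
proof
  fix c d :: 'k and f g :: "'k L2"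
  show "scaleL2 c (f + g) = scaleL2 c f + scaleL2 c g"
    by transfer (auto simp: L2_rel_def sq_integrable_add sq_integrable_mult_const distrib_left)
  show "scaleL2 (c + d) f = scaleL2 c f + scaleL2 d f"
    by transfer (auto simp: L2_rel_def sq_integrable_add sq_integrable_mult_const distrib_right)
  show "scaleL2 c (scaleL2 d f) = scaleL2 (c * d) f"
    by transfer (auto simp: L2_rel_def sq_integrable_mult_const mult.assoc)
  show "scaleL2 1 f = f"
    by transfer (auto simp: L2_rel_def)
qed

lemma vector_space_scaleL1:
  "vector_space (scaleL1 :: 'k::{real_normed_field, euclidean_space} \<Rightarrow> _)"
proof
  fix c d :: 'k and f g :: "'k L1"
  show "scaleL1 c (f + g) = scaleL1 c f + scaleL1 c g"
    by transfer (auto simp: L1_rel_def distrib_left)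
  show "scaleL1 (c + d) f = scaleL1 c f + scaleL1 d f"
    by transfer (auto simp: L1_rel_def distrib_right)
  show "scaleL1 c (scaleL1 d f) = scaleL1 (c * d) f"
    by transfer (auto simp: L1_rel_def mult.assoc)
  show "scaleL1 1 f = f"
    by transfer (auto simp: L1_rel_def)
qed

section \<open>Finite-dimensional subspaces and homogeneous polynomials\<close>

definition fin_dim_subspace ::
    "('k::field \<Rightarrow> 'e::ab_group_add \<Rightarrow> 'e) \<Rightarrow> 'e set \<Rightarrow> bool"
  where "fin_dim_subspace s G \<longleftrightarrow>
    module.subspace s G \<and> (\<exists>B. finite B \<and> B \<subseteq> G \<and> module.span s B = G)"

text \<open>
  An \<open>n\<close>-tuple in \<open>E\<close> is an extensional function on \<open>{..<n}\<close>.  On these, the topology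
  of \<^typ>\<open>nat \<Rightarrow> 'e::topological_space\<close> restricts to the product topology of \<open>E\<^sup>n\<close>.
\<close>

definition n_linear ::
    "('k::field \<Rightarrow> 'e::ab_group_add \<Rightarrow> 'e) \<Rightarrow> ('k \<Rightarrow> 'f::ab_group_add \<Rightarrow> 'f) \<Rightarrow>
      nat \<Rightarrow> ((nat \<Rightarrow> 'e) \<Rightarrow> 'f) \<Rightarrow> bool"
  where "n_linear s\<^sub>E s\<^sub>F n A \<longleftrightarrow>
    (\<forall>v \<in> {..<n} \<rightarrow>\<^sub>E UNIV. \<forall>i<n. Vector_Spaces.linear s\<^sub>E s\<^sub>F (\<lambda>x. A (v(i := x))))"

definition cont_hom_poly ::
    "('k::field \<Rightarrow> 'e::real_normed_vector \<Rightarrow> 'e) \<Rightarrow> ('k \<Rightarrow> 'f::real_normed_vector \<Rightarrow> 'f) \<Rightarrow>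
      nat \<Rightarrow> ('e \<Rightarrow> 'f) \<Rightarrow> bool"
  where "cont_hom_poly s\<^sub>E s\<^sub>F n Q \<longleftrightarrow>
    (\<exists>A. n_linear s\<^sub>E s\<^sub>F n A \<and> continuous_on ({..<n} \<rightarrow>\<^sub>E UNIV) A \<and>
      (\<forall>x. Q x = A (\<lambda>i\<in>{..<n}. x)))"

section \<open>Summability\<close>

text \<open>Sequences are indexed from \<open>0\<close> instead of \<open>1\<close>.\<close>

definition dual_space ::
    "('k::real_normed_field \<Rightarrow> 'e::real_normed_vector \<Rightarrow> 'e) \<Rightarrow> ('e \<Rightarrow> 'k) set"
  where "dual_space s = {\<phi>. bounded_linear \<phi> \<and> (\<forall>c x. \<phi> (s c x) = c * \<phi> x)}"

definition l1_seq :: "(nat \<Rightarrow> 'f::real_normed_vector) set"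
  where "l1_seq = {y. summable (\<lambda>j. norm (y j))}"

definition l1_weak ::
    "('k::real_normed_field \<Rightarrow> 'e::real_normed_vector \<Rightarrow> 'e) \<Rightarrow> (nat \<Rightarrow> 'e) set"
  where "l1_weak s = {x. \<forall>\<phi>\<in>dual_space s. (\<lambda>j. \<phi> (x j)) \<in> l1_seq}"

text \<open>
  The weak norm takes values in \<^typ>\<open>ennreal\<close>, so that the supremum and the sums exist for every
  sequence.
\<close>

definition weak_norm ::
    "('k::real_normed_field \<Rightarrow> 'e::real_normed_vector \<Rightarrow> 'e) \<Rightarrow> (nat \<Rightarrow> 'e) \<Rightarrow> ennreal"
  where "weak_norm s x =
    (SUP \<phi> \<in> {\<phi> \<in> dual_space s. onorm \<phi> \<le> 1}. \<Sum>j. ennreal (norm (\<phi> (x j))))"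

definition l1_uncond ::
    "('k::real_normed_field \<Rightarrow> 'e::real_normed_vector \<Rightarrow> 'e) \<Rightarrow> (nat \<Rightarrow> 'e) set"
  where "l1_uncond s =
    {x \<in> l1_weak s. (\<lambda>k. weak_norm s (\<lambda>j. x (k + j))) \<longlonglongrightarrow> 0}"

definition one_summing_at ::
    "('k::real_normed_field \<Rightarrow> 'e::real_normed_vector \<Rightarrow> 'e) \<Rightarrow>
      ('e \<Rightarrow> 'f::real_normed_vector) \<Rightarrow> 'e \<Rightarrow> bool"
  where "one_summing_at s f a \<longleftrightarrow>
    (\<forall>x\<in>l1_uncond s. (\<lambda>j. f (a + x j) - f a) \<in> l1_seq)"

definition one_summing_set ::
    "('k::real_normed_field \<Rightarrow> 'e::real_normed_vector \<Rightarrow> 'e) \<Rightarrow>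
      ('e \<Rightarrow> 'f::real_normed_vector) \<Rightarrow> 'e set"
  where "one_summing_set s f = {a. one_summing_at s f a}"

end

theory Submission
  imports Defs
begin

text \<open>
  A finite-dimensional subspace \<open>G\<close> of \<open>L\<^sub>2\<close> is the common kernel of a sequence of continuous
  functionals \<open>\<psi>\<^sub>k\<close>, which may be scaled to satisfy \<open>\<parallel>\<psi>\<^sub>k\<parallel> \<le> 2\<^sup>-\<^sup>k\<close>
  (\<open>fin_dim_subspace_common_kernel\<close>).  Cut out of the interval countably many disjoint slabs and
  let \<open>Q(x)\<close> be the function that equals \<open>\<psi>\<^sub>k(x)\<^sup>n\<^sup>-\<^sup>1 x(t)\<close> for \<open>t\<close> in the \<open>k\<close>-th slab.  This is an
  \<open>n\<close>-homogeneous polynomial with values in \<open>L\<^sub>1\<close>; it is the product of \<open>x\<close> with a step function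
  that depends on the numbers \<open>\<psi>\<^sub>k(x)\<close> only (\<open>cont_hom_poly_slab_mult_power\<close>).

  Write \<open>M\<^sub>a\<close> for multiplication by the step function belonging to \<open>a\<close>.  Then
  \<open>Q(a + x) - Q(a) = M\<^sub>a x + (M\<^sub>a\<^sub>+\<^sub>x - M\<^sub>a) (a + x)\<close>.  The multiplier in the second term is bounded by
  a constant times \<open>sup\<^sub>k \<bar>\<psi>\<^sub>k(x)\<bar>\<close>, and since the norms of the \<open>\<psi>\<^sub>k\<close> are summable, this is
  absolutely summable along every unconditionally summable sequence.  So \<open>Q\<close> is 1-summing at \<open>a\<close>
  if and only if the linear operator \<open>M\<^sub>a\<close> is (\<open>one_summing_at_slab_mult_power_iff\<close>).

  If \<open>a\<close> lies in \<open>G\<close>, then \<open>M\<^sub>a = 0\<close>; here \<open>n \<ge> 2\<close> is used.  If not, then some \<open>\<psi>\<^sub>k(a)\<close> is nonzero,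
  and the multiplier of \<open>M\<^sub>a\<close> is a nonzero constant on an interval.  The functions \<open>sin(jt)/j\<close>
  are orthogonal with square-summable norms, hence unconditionally summable, but their \<open>L\<^sub>1\<close>
  norms over an interval are of order \<open>1/j\<close>, so \<open>M\<^sub>a\<close> is not summing (\<open>slab_mult_summing_iff\<close>).
\<close>

section \<open>Functionals and inner product on \<open>L\<^sub>2\<close>\<close>

text \<open>
  The bilinear pairing, without conjugation, makes sense over every scalar field under
  consideration; it produces the scalar-linear functionals \<open>\<lambda>f. pairing f g\<close>.
\<close>

lift_definition pairing :: "'k L2 \<Rightarrow> 'k L2 \<Rightarrow> 'k::{real_normed_field, euclidean_space}"
  is "\<lambda>f g. \<integral>t. f t * g t \<partial>Leb"
  unfolding L2_rel_def sq_integrable_def by (intro integral_cong_AE) auto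

lemma sq_integrable_times_integrable:
  assumes "sq_integrable f" "sq_integrable g"
  shows "integrable Leb (\<lambda>t. f t * g t)"
  by (rule Bochner_Integration.integrable_bound[OF sq_integrable_mult[OF assms]])
    (use assms in \<open>auto simp: sq_integrable_def norm_mult\<close>)

lemma sq_integrable_inner_integrable:
  assumes "sq_integrable f" "sq_integrable g"
  shows "integrable Leb (\<lambda>t. f t \<bullet> g t)"
  by (rule Bochner_Integration.integrable_bound[OF sq_integrable_mult[OF assms]])
    (use assms in \<open>auto simp: sq_integrable_def Cauchy_Schwarz_ineq2\<close>)

lemma pairing_add_left: "pairing (f + g) h = pairing f h + pairing g h"
  by transfer (simp add: L2_rel_def distrib_right sq_integrable_times_integrable)

lemma pairing_scale_left: "pairing (scaleL2 c f) h = c * pairing f h"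
  by transfer (simp add: mult.assoc)

lemma norm_pairing_le: "norm (pairing f g) \<le> norm f * norm g"
proof (transfer, unfold L2_rel_def)
  fix f g :: "real \<Rightarrow> 'a"
  assume "sq_integrable f \<and> sq_integrable f \<and> (AE t in Leb. f t = f t)"
    "sq_integrable g \<and> sq_integrable g \<and> (AE t in Leb. g t = g t)"
  then have f: "sq_integrable f" and g: "sq_integrable g" by auto
  have "norm (\<integral>t. f t * g t \<partial>Leb) \<le> (\<integral>t. norm (f t) * norm (g t) \<partial>Leb)"
    using integral_norm_bound[of Leb "\<lambda>t. f t * g t"] by (simp add: norm_mult)
  also note sq_integrable_Cauchy_Schwarz[OF f g]
  finally show "norm (\<integral>t. f t * g t \<partial>Leb) \<le>
    sqrt (\<integral>t. (norm (f t))\<^sup>2 \<partial>Leb) * sqrt (\<integral>t. (norm (g t))\<^sup>2 \<partial>Leb)" .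
qed

lemma dual_spaceI:
  assumes "\<And>x y. \<phi> (x + y) = \<phi> x + \<phi> y" "\<And>c x. \<phi> (scaleL2 c x) = c * \<phi> x"
    and "\<And>x. norm (\<phi> x) \<le> norm x * B"
  shows "\<phi> \<in> dual_space scaleL2"
proof -
  have "bounded_linear \<phi>"
    by (rule bounded_linear_intro[where K = B])
      (use assms scaleL2_of_real in \<open>auto simp: scaleR_conv_of_real simp flip: scaleL2_of_real\<close>)
  with assms show ?thesis
    by (simp add: dual_space_def)
qed

lemma pairing_in_dual_space: "(\<lambda>f. pairing f g) \<in> dual_space scaleL2"
  by (rule dual_spaceI[where B = "norm g"])
    (auto simp: pairing_add_left pairing_scale_left norm_pairing_le)

text \<open>
  Over the complex numbers \<open>\<bar>z\<bar>\<^sup>2 / z\<close> is the conjugate of \<open>z\<close>.  Written with the inverse, it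
  is available in every normed field, and it turns the bilinear pairing into the norm.
\<close>

lemma norm_sq_scaleR_inverse:
  fixes z :: "'k::real_normed_field"
  shows "norm ((norm z)\<^sup>2 *\<^sub>R inverse z) = norm z"
  by (cases "z = 0") (simp_all add: norm_inverse power2_eq_square)

lift_definition dual_function :: "'k L2 \<Rightarrow> 'k::{real_normed_field, euclidean_space} L2"
  is "\<lambda>f t. (norm (f t))\<^sup>2 *\<^sub>R inverse (f t)"
proof -
  show "L2_rel (\<lambda>t. (norm (f t))\<^sup>2 *\<^sub>R inverse (f t)) (\<lambda>t. (norm (g t))\<^sup>2 *\<^sub>R inverse (g t))"
    if "L2_rel f g" for f g :: "real \<Rightarrow> 'k"
    using that by (auto simp: L2_rel_def sq_integrable_def norm_sq_scaleR_inverse simp del: norm_scaleR elim: AE_mp)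
qed

lemma norm_dual_function: "norm (dual_function f) = norm f"
  by transfer (simp add: norm_sq_scaleR_inverse del: norm_scaleR)

lemma pairing_dual_function: "pairing f (dual_function f) = of_real ((norm f)\<^sup>2)"
proof (transfer, unfold L2_rel_def)
  fix f :: "real \<Rightarrow> 'a"
  assume "sq_integrable f \<and> sq_integrable f \<and> (AE t in Leb. f t = f t)"
  then have int: "integrable Leb (\<lambda>t. (norm (f t))\<^sup>2)"
    by (simp add: sq_integrable_def)
  have "(\<integral>t. f t * ((norm (f t))\<^sup>2 *\<^sub>R inverse (f t)) \<partial>Leb) = (\<integral>t. of_real ((norm (f t))\<^sup>2) \<partial>Leb)"
    by (intro Bochner_Integration.integral_cong) (auto simp: scaleR_conv_of_real field_simps)
  also have "\<dots> = of_real (\<integral>t. (norm (f t))\<^sup>2 \<partial>Leb)"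
    using integral_bounded_linear[OF bounded_linear_of_real int] .
  finally show "(\<integral>t. f t * ((norm (f t))\<^sup>2 *\<^sub>R inverse (f t)) \<partial>Leb) =
      of_real ((sqrt (\<integral>t. (norm (f t))\<^sup>2 \<partial>Leb))\<^sup>2)"
    by simp
qed

text \<open>
  The real inner product gives access to Pythagoras' theorem for finite orthogonal sums.
\<close>

instantiation L2 :: ("{real_normed_field, euclidean_space}") real_inner
begin

lift_definition inner_L2 :: "'a L2 \<Rightarrow> 'a L2 \<Rightarrow> real"
  is "\<lambda>f g. \<integral>t. f t \<bullet> g t \<partial>Leb"
  unfolding L2_rel_def sq_integrable_def by (intro integral_cong_AE) auto

instance
proof
  fix f g h :: "'a L2" and r :: real
  show "f \<bullet> g = g \<bullet> f"
    by transfer (simp add: inner_commute)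
  show "(f + g) \<bullet> h = f \<bullet> h + g \<bullet> h"
    by transfer (simp add: L2_rel_def inner_add_left sq_integrable_inner_integrable)
  show "(r *\<^sub>R f) \<bullet> g = r * (f \<bullet> g)"
    by transfer simp
  show n: "norm f = sqrt (f \<bullet> f)"
    by transfer (simp add: power2_norm_eq_inner)
  show "0 \<le> f \<bullet> f"
    by transfer simp
  then show "f \<bullet> f = 0 \<longleftrightarrow> f = 0"
    using n by (metis norm_eq_zero real_sqrt_eq_zero_cancel_iff)
qed

end

section \<open>Integrals over half-lines separate points\<close>

lemma bounded_sq_integrable:
  assumes "f \<in> borel_measurable Leb" "\<And>t. norm (f t) \<le> B"
  shows "sq_integrable f"
proof -
  interpret finite_measure Leb
    by (rule finite_measure_lebesgue_on) auto
  have "integrable Leb (\<lambda>t. (norm (f t))\<^sup>2)"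
    by (rule integrable_const_bound[where B = "B\<^sup>2"])
      (use assms in \<open>auto intro!: AE_I2 power_mono\<close>)
  with assms show ?thesis
    by (simp add: sq_integrable_def)
qed

lift_definition half_line :: "real \<Rightarrow> 'k::{real_normed_field, euclidean_space} L2"
  is "\<lambda>r t. indicator {..r} t"
proof -
  fix r
  have "sq_integrable (indicator {..r} :: real \<Rightarrow> 'k)"
    by (rule bounded_sq_integrable[where B = 1])
      (auto intro!: borel_measurable_if_I simp: indicator_def measurable_completion measurable_restrict_space1)
  then show "L2_rel (indicator {..r} :: real \<Rightarrow> 'k) (indicator {..r})"
    by (simp add: L2_rel_def)
qed

lemma sq_integrable_integrable: "sq_integrable f \<Longrightarrow> integrable Leb f"
  using sq_integrable_times_integrable[of f "\<lambda>_. 1"]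
    bounded_sq_integrable[of "\<lambda>_. 1" 1] by simp

text \<open>
  Rational end points are what makes the total family of functionals below countable.
\<close>

lemma borel_eq_rational_half_lines: "(borel :: real measure) = sigma UNIV (atMost ` \<rat>)"
proof (rule borel_eq_sigmaI1[OF borel_eq_atMost])
  fix X :: "real set" assume "X \<in> range atMost"
  then obtain a where X: "X = {..a}" by auto
  have "X = (\<Inter>r\<in>\<rat> \<inter> {a<..}. {..r})"
  proof
    show "(\<Inter>r\<in>\<rat> \<inter> {a<..}. {..r}) \<subseteq> X"
    proof
      fix x assume x: "x \<in> (\<Inter>r\<in>\<rat> \<inter> {a<..}. {..r})"
      have "x \<le> a"
      proof (rule ccontr)
        assume "\<not> x \<le> a"
        then obtain r where "r \<in> \<rat>" "a < r" "r < x"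
          using Rats_dense_in_real[of a x] by auto
        with x show False by force
      qed
      then show "x \<in> X" by (simp add: X)
    qed
  qed (auto simp: X)
  also have "\<dots> \<in> sets (sigma UNIV (atMost ` \<rat>))"
  proof (rule sets.countable_INT')
    show "countable (\<rat> \<inter> {a<..})"
      by (rule countable_subset[OF _ countable_rat]) auto
    obtain r where "r \<in> \<rat>" "a < r"
      using Rats_dense_in_real[of a "a + 1"] by auto
    then show "\<rat> \<inter> {a<..} \<noteq> {}" by blast
    show "atMost ` (\<rat> \<inter> {a<..}) \<subseteq> sets (sigma UNIV (atMost ` \<rat>))"
      by (auto simp: sets_measure_of_conv)
  qed
  finally show "X \<in> sets (sigma UNIV (atMost ` \<rat>))" .
qed auto

text \<open>
  The functionals \<open>f \<mapsto> \<integral> f\<close> over the rational half-lines separate the points of \<open>L\<^sub>2\<close>: the sets on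
  which \<open>f\<close> integrates to zero form a Dynkin system that contains an intersection-stable
  generator of the Borel sets, and every Lebesgue set differs from a Borel set by a null set.
  A function whose integral over every measurable set is zero vanishes almost everywhere.
\<close>

lemma pairing_half_lines_eq_0:
  fixes f :: "'k::{real_normed_field, euclidean_space} L2"
  assumes "\<And>r. r \<in> \<rat> \<Longrightarrow> pairing f (half_line r) = 0"
  shows "f = 0"
  using assms
proof (transfer, unfold L2_rel_def)
  fix f :: "real \<Rightarrow> 'k"
  assume "sq_integrable f \<and> sq_integrable f \<and> (AE t in Leb. f t = f t)"
    and z: "\<And>r. r \<in> \<rat> \<Longrightarrow> (\<integral>t. f t * indicator {..r} t \<partial>Leb) = 0"
  then have f: "sq_integrable f" by simp
  have int: "integrable Leb f"
    using f by (rule sq_integrable_integrable)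
  have [measurable]: "A \<inter> {-pi..pi} \<in> sets Leb" if "A \<in> sets borel" for A
    using that by (auto simp: sets_restrict_space)
  let ?I = "\<lambda>S. set_lebesgue_integral Leb (S \<inter> {-pi..pi}) f"
  have set_int: "set_integrable Leb (S \<inter> {-pi..pi}) f" if "S \<in> sets borel" for S
    using that int unfolding set_integrable_def by (intro integrable_mult_indicator) auto
  have rat: "?I {..r} = 0" if "r \<in> \<rat>" for r
  proof -
    have "?I {..r} = (\<integral>t. f t * indicator {..r} t \<partial>Leb)"
      unfolding set_lebesgue_integral_def
      by (intro Bochner_Integration.integral_cong) (auto simp: indicator_def)
    with z[OF that] show ?thesis by simp
  qed
  have total: "?I UNIV = 0"
  proof -
    \<comment> \<open>Some rational half-line contains the whole interval; \<open>4 > \<pi>\<close> will do.\<close>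
    have "UNIV \<inter> {-pi..pi} = {..4} \<inter> {-pi..pi}"
      using pi_less_4 by auto
    with rat[of 4] show ?thesis by simp
  qed
  have borel: "?I S = 0" if "S \<in> sets borel" for S
  proof -
    have eq: "sets borel = sigma_sets UNIV (atMost ` (\<rat> :: real set))"
      by (subst borel_eq_rational_half_lines) simp
    have "Int_stable (atMost ` \<rat> :: real set set)"
      by (auto simp: Int_stable_def min_def)
    moreover have "atMost ` (\<rat> :: real set) \<subseteq> Pow UNIV"
      by simp
    moreover have "S \<in> sigma_sets UNIV (atMost ` \<rat>)"
      using that eq by simp
    ultimately show ?thesis
    proof (induction rule: sigma_sets_induct_disjoint[where P = "\<lambda>S. ?I S = 0"])
      case (compl S)
      have "(S \<inter> {-pi..pi}) \<union> ((UNIV - S) \<inter> {-pi..pi}) = UNIV \<inter> {-pi..pi}"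
        by auto
      moreover have "set_lebesgue_integral Leb ((S \<inter> {-pi..pi}) \<union> ((UNIV - S) \<inter> {-pi..pi})) f =
          ?I S + ?I (UNIV - S)"
        using compl.hyps by (intro set_integral_Un set_int) (auto simp flip: eq)
      ultimately show ?case
        using total compl.IH by simp
    next
      case (union A)
      have A: "A i \<in> sets borel" for i
        using union.hyps eq by auto
      have eq': "(\<Union>i. A i) \<inter> {-pi..pi} = (\<Union>i. A i \<inter> {-pi..pi})"
        by auto
      have "?I (\<Union>i. A i) = (\<Sum>i. ?I (A i))"
        unfolding eq'
      proof (rule lebesgue_integral_countable_add)
        show "A i \<inter> {-pi..pi} \<in> sets Leb" for i
          using A by measurable
        show "(A i \<inter> {-pi..pi}) \<inter> (A j \<inter> {-pi..pi}) = {}" if "i \<noteq> j" for i j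
          using union.hyps(1) that unfolding disjoint_family_on_def by blast
        show "set_integrable Leb (\<Union>i. A i \<inter> {-pi..pi}) f"
          unfolding eq'[symmetric] using A by (intro set_int) auto
      qed
      then show ?case
        using union.IH by simp
    next
      case (basic S)
      then show ?case
        using rat by blast
    qed (simp add: set_lebesgue_integral_def)
  qed
  interpret finite_measure Leb
    by (rule finite_measure_lebesgue_on) auto
  have "AE t in Leb. f t = 0"
  proof (rule density_zero[OF int])
    fix A assume A: "A \<in> sets Leb"
    then have "A \<in> sets lebesgue" "A \<subseteq> {-pi..pi}"
      by (auto simp: sets_restrict_space)
    then obtain S N N' where S: "A = S \<union> N" "N \<subseteq> N'" "N' \<in> null_sets lborel" "S \<in> sets borel"
      by (elim sets_completionE) (simp only: sets_lborel)
    then have "AE t in lebesgue. t \<notin> N'"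
      by (intro AE_not_in null_sets_completionI)
    then have "AE t in Leb. t \<notin> N'"
      by (subst AE_restrict_space_iff) auto
    then have "AE t in Leb. t \<in> A \<longleftrightarrow> t \<in> S \<inter> {-pi..pi}"
      by (rule AE_mp) (use S in \<open>auto intro!: AE_I2\<close>)
    then have "AE t in Leb. indicator A t *\<^sub>R f t = indicator (S \<inter> {-pi..pi}) t *\<^sub>R f t"
      by eventually_elim (auto simp: indicator_def)
    then have "set_lebesgue_integral Leb A f = ?I S"
      unfolding set_lebesgue_integral_def
      using A set_int[of S] S f
      by (intro integral_cong_AE) (auto simp: sq_integrable_def)
    with borel S show "set_lebesgue_integral Leb A f = 0" by simp
  qed
  with f show "sq_integrable f \<and> sq_integrable (\<lambda>t. 0) \<and> (AE t in Leb. f t = 0)"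
    by (simp add: sq_integrable_zero)
qed

section \<open>Finite-dimensional subspaces as common kernels\<close>

interpretation L2: vector_space "scaleL2 :: 'k \<Rightarrow> 'k L2 \<Rightarrow> 'k::{real_normed_field, euclidean_space} L2"
  by (rule vector_space_scaleL2)

lemma dual_space_add: "\<phi> \<in> dual_space s \<Longrightarrow> \<phi> (x + y) = \<phi> x + \<phi> y"
  by (simp add: dual_space_def linear_simps)

lemma dual_space_scale: "\<phi> \<in> dual_space s \<Longrightarrow> \<phi> (s c x) = c * \<phi> x"
  by (simp add: dual_space_def)

lemma dual_space_diff: "\<phi> \<in> dual_space s \<Longrightarrow> \<phi> (x - y) = \<phi> x - \<phi> y"
  by (simp add: dual_space_def linear_simps)

lemma dual_space_combination:
  assumes "\<phi> \<in> dual_space s" "\<psi> \<in> dual_space s"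
  shows "(\<lambda>x. \<phi> x - c * \<psi> x) \<in> dual_space s"
  using assms unfolding dual_space_def
  by (auto intro!: bounded_linear_sub bounded_linear_const_mult simp: algebra_simps)

lemma dual_space_const_mult:
  assumes "\<phi> \<in> dual_space s"
  shows "(\<lambda>x. c * \<phi> x) \<in> dual_space s"
  using assms unfolding dual_space_def
  by (auto intro!: bounded_linear_const_mult simp: algebra_simps)

text \<open>
  Finite-dimensional subspaces are annihilators of sequences of functionals.  The empty span is
  the common kernel of the half-line integrals.  To add a vector \<open>b\<close> outside the kernel, choose
  \<open>m\<close> with \<open>\<psi>\<^sub>m b \<noteq> 0\<close> and replace each \<open>\<psi>\<^sub>k\<close> by \<open>\<psi>\<^sub>k - (\<psi>\<^sub>k b / \<psi>\<^sub>m b) \<psi>\<^sub>m\<close>: these vanish at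
  \<open>x\<close> exactly if some \<open>x - c b\<close> lies in the old kernel, namely for \<open>c = \<psi>\<^sub>m x / \<psi>\<^sub>m b\<close>.
\<close>

lemma span_eq_common_kernel:
  fixes B :: "'k::{real_normed_field, euclidean_space} L2 set"
  assumes "finite B"
  shows "\<exists>\<psi> :: nat \<Rightarrow> _. (\<forall>k. \<psi> k \<in> dual_space scaleL2) \<and> {x. \<forall>k. \<psi> k x = 0} = L2.span B"
  using assms
proof (induction B)
  case empty
  define r where "r = from_nat_into (\<rat> :: real set)"
  have r: "range r = \<rat>"
    unfolding r_def using Rats_0 by (intro range_from_nat_into countable_rat) blast
  have "x = 0" if "\<forall>k. pairing x (half_line (r k)) = 0" for x :: "'k L2"
    using that r by (intro pairing_half_lines_eq_0) (metis rangeE)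
  moreover have "pairing (0 :: 'k L2) g = 0" for g
    using pairing_scale_left[of 0 0 g] by simp
  ultimately show ?case
    by (intro exI[of _ "\<lambda>k f. pairing f (half_line (r k))"]) (auto simp: pairing_in_dual_space)
next
  case (insert b B)
  then obtain \<psi> :: "nat \<Rightarrow> _" where dual: "\<And>k. \<psi> k \<in> dual_space scaleL2"
    and ker: "{x. \<forall>k. \<psi> k x = 0} = L2.span B"
    by auto
  show ?case
  proof (cases "b \<in> L2.span B")
    case True
    then have "L2.span (insert b B) = L2.span B"
      by (rule L2.span_redundant)
    with dual ker show ?thesis by auto
  next
    case False
    then obtain m where m: "\<psi> m b \<noteq> 0"
      using ker by auto
    define \<psi>' where "\<psi>' k x = \<psi> k x - (\<psi> k b / \<psi> m b) * \<psi> m x" for k x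
    have "x \<in> L2.span (insert b B) \<longleftrightarrow> (\<forall>k. \<psi>' k x = 0)" for x
    proof -
      have "x \<in> L2.span (insert b B) \<longleftrightarrow> (\<exists>c. \<forall>k. \<psi> k x = c * \<psi> k b)"
        by (simp add: L2.span_breakdown_eq flip: ker)
          (simp add: dual_space_diff[OF dual] dual_space_scale[OF dual])
      also have "\<dots> \<longleftrightarrow> (\<forall>k. \<psi> k x = (\<psi> m x / \<psi> m b) * \<psi> k b)"
        using m by (metis nonzero_mult_div_cancel_right)
      also have "\<dots> \<longleftrightarrow> (\<forall>k. \<psi>' k x = 0)"
        by (simp add: \<psi>'_def mult.commute)
      finally show ?thesis .
    qed
    moreover have "\<psi>' k \<in> dual_space scaleL2" for k
      unfolding \<psi>'_def by (intro dual_space_combination dual)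
    ultimately show ?thesis by blast
  qed
qed

text \<open>
  Rescaling the functionals does not change their kernels, so their norms can be made summable.
\<close>

lemma fin_dim_subspace_common_kernel:
  fixes G :: "'k::{real_normed_field, euclidean_space} L2 set"
  assumes "fin_dim_subspace scaleL2 G"
  obtains \<psi> :: "nat \<Rightarrow> 'k L2 \<Rightarrow> 'k" where "\<And>k. \<psi> k \<in> dual_space scaleL2"
    and "\<And>k x. norm (\<psi> k x) \<le> (1/2) ^ k * norm x" and "{x. \<forall>k. \<psi> k x = 0} = G"
proof -
  obtain \<psi> :: "nat \<Rightarrow> 'k L2 \<Rightarrow> 'k" where dual: "\<And>k. \<psi> k \<in> dual_space scaleL2"
    and ker: "{x. \<forall>k. \<psi> k x = 0} = G"
    using assms span_eq_common_kernel unfolding fin_dim_subspace_def by metis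
  define d where "d k = (1/2) ^ k / (onorm (\<psi> k) + 1)" for k
  have bl: "bounded_linear (\<psi> k)" for k
    using dual[of k] by (simp add: dual_space_def)
  have d: "d k > 0" for k
    using onorm_pos_le[OF bl[of k]] by (simp add: d_def)
  show ?thesis
  proof (rule that[of "\<lambda>k x. of_real (d k) * \<psi> k x"])
    show "(\<lambda>x. of_real (d k) * \<psi> k x) \<in> dual_space scaleL2" for k
      by (intro dual_space_const_mult dual)
    show "{x. \<forall>k. of_real (d k) * \<psi> k x = 0} = G"
      using d by (simp add: ker less_imp_neq[symmetric])
    show "norm (of_real (d k) * \<psi> k x) \<le> (1/2) ^ k * norm x" for k x
    proof -
      have "norm (\<psi> k x) \<le> (onorm (\<psi> k) + 1) * norm x"
        using onorm[OF bl, of k x] norm_ge_zero[of x] unfolding distrib_right by linarith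
      then have "d k * norm (\<psi> k x) \<le> d k * ((onorm (\<psi> k) + 1) * norm x)"
        using d[of k] by (simp add: mult_left_mono less_imp_le)
      also have "\<dots> = (1/2) ^ k * norm x"
        using onorm_pos_le[OF bl[of k]] by (simp add: d_def)
      finally show ?thesis
        using d[of k] by (simp add: norm_mult)
    qed
  qed
qed

section \<open>Unconditionally summable sequences in \<open>L\<^sub>2\<close>\<close>

text \<open>
  A tail of weak norm at most \<open>1\<close> bounds all functionals of the unit ball simultaneously; this is
  the only form in which unconditional summability of a given sequence is used.
\<close>

lemma l1_uncond_tail:
  assumes "x \<in> l1_uncond s"
  shows "\<exists>N. \<forall>\<phi>\<in>dual_space s. (\<forall>y. norm (\<phi> y) \<le> norm y) \<longrightarrow>
    (\<forall>M. (\<Sum>j<M. norm (\<phi> (x (N + j)))) \<le> 1)"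
proof -
  have "(\<lambda>k. weak_norm s (\<lambda>j. x (k + j))) \<longlonglongrightarrow> 0"
    using assms by (simp add: l1_uncond_def)
  then have "eventually (\<lambda>k. weak_norm s (\<lambda>j. x (k + j)) < 1) sequentially"
    by (rule order_tendstoD) simp
  then obtain N where N: "weak_norm s (\<lambda>j. x (N + j)) < 1"
    by (auto simp: eventually_sequentially)
  show ?thesis
  proof (intro exI[of _ N] ballI impI allI)
    fix \<phi> M assume \<phi>: "\<phi> \<in> dual_space s" "\<forall>y. norm (\<phi> y) \<le> norm y"
    have "onorm \<phi> \<le> 1"
      using \<phi>(2) by (intro onorm_bound) auto
    have "ennreal (\<Sum>j<M. norm (\<phi> (x (N + j)))) = (\<Sum>j<M. ennreal (norm (\<phi> (x (N + j)))))"
      by (simp add: sum_ennreal)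
    also have "\<dots> \<le> (\<Sum>j. ennreal (norm (\<phi> (x (N + j)))))"
      by (intro sum_le_suminf) auto
    also have "\<dots> \<le> weak_norm s (\<lambda>j. x (N + j))"
      unfolding weak_norm_def using \<phi> \<open>onorm \<phi> \<le> 1\<close> by (intro SUP_upper) auto
    also have "\<dots> \<le> ennreal 1"
      using N by simp
    finally show "(\<Sum>j<M. norm (\<phi> (x (N + j)))) \<le> 1"
      by (subst (asm) ennreal_le_iff) auto
  qed
qed

text \<open>
  The norming functional of \<open>x\<close> is pairing with \<^const>\<open>dual_function\<close> of \<open>x\<close>, divided by the norm
  of \<open>x\<close>, which takes the place of a functional from the Hahn-Banach theorem.
\<close>

lemma norm_le_1_of_functionals_le_1:
  fixes x :: "'k::{real_normed_field, euclidean_space} L2"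
  assumes "\<And>\<phi>. \<phi> \<in> dual_space scaleL2 \<Longrightarrow> (\<And>y. norm (\<phi> y) \<le> norm y) \<Longrightarrow> norm (\<phi> x) \<le> 1"
  shows "norm x \<le> 1"
proof (cases "x = 0")
  case False
  define \<phi> where "\<phi> = (\<lambda>y. of_real (inverse (norm x)) * pairing y (dual_function x))"
  have "\<phi> \<in> dual_space scaleL2"
    unfolding \<phi>_def by (intro dual_space_const_mult pairing_in_dual_space)
  moreover have "norm (\<phi> y) \<le> norm y" for y
  proof -
    have "norm (\<phi> y) = norm (pairing y (dual_function x)) / norm x"
      by (simp add: \<phi>_def norm_mult norm_inverse divide_inverse mult.commute)
    also have "\<dots> \<le> norm y"
      using norm_pairing_le[of y "dual_function x"] False
      by (simp add: norm_dual_function pos_divide_le_eq)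
    finally show ?thesis .
  qed
  moreover have "norm (\<phi> x) = norm x"
    using False by (simp add: \<phi>_def pairing_dual_function norm_mult norm_inverse power2_eq_square)
  ultimately show ?thesis
    using assms[of \<phi>] by simp
qed simp

text \<open>
  With unimodular scalars \<open>c\<^sub>j\<close> that make every \<open>c\<^sub>j \<phi>(x\<^sub>j)\<close> nonnegative, the left-hand side is
  the value of \<open>\<phi>\<close> at \<open>\<Sum> c\<^sub>j x\<^sub>j\<close>, whose norm is given by Pythagoras' theorem.  Orthogonality is
  required of all scalar multiples because the inner product is only real.
\<close>

lemma sum_norm_functional_orthogonal_le:
  fixes x :: "nat \<Rightarrow> 'k::{real_normed_field, euclidean_space} L2"
  assumes orth: "\<And>i j c d. i \<noteq> j \<Longrightarrow> scaleL2 c (x i) \<bullet> scaleL2 d (x j) = 0"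
    and \<phi>: "\<phi> \<in> dual_space scaleL2" and "finite I"
  shows "(\<Sum>j\<in>I. norm (\<phi> (x j))) \<le> onorm \<phi> * sqrt (\<Sum>j\<in>I. (norm (x j))\<^sup>2)"
proof -
  have bl: "bounded_linear \<phi>"
    using \<phi> by (simp add: dual_space_def)
  define c where "c j = (if \<phi> (x j) = 0 then 1 else of_real (norm (\<phi> (x j))) / \<phi> (x j))" for j
  have [simp]: "norm (c j) = 1" for j
    by (simp add: c_def norm_divide)
  have c: "c j * \<phi> (x j) = of_real (norm (\<phi> (x j)))" for j
    by (simp add: c_def)
  define y where "y j = scaleL2 (c j) (x j)" for j
  have "\<phi> (\<Sum>j\<in>I. y j) = (\<Sum>j\<in>I. \<phi> (y j))"
    by (rule linear_sum[OF bounded_linear.linear[OF bl]])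
  also have "\<dots> = of_real (\<Sum>j\<in>I. norm (\<phi> (x j)))"
    by (simp add: y_def dual_space_scale[OF \<phi>] c)
  finally have "(\<Sum>j\<in>I. norm (\<phi> (x j))) = norm (\<phi> (\<Sum>j\<in>I. y j))"
    by (simp add: sum_nonneg del: of_real_sum)
  also have "\<dots> \<le> onorm \<phi> * norm (\<Sum>j\<in>I. y j)"
    by (rule onorm[OF bl])
  also have "(norm (\<Sum>j\<in>I. y j))\<^sup>2 = (\<Sum>j\<in>I. (norm (y j))\<^sup>2)"
    using \<open>finite I\<close> orth by (intro norm_sum_Pythagorean) (auto simp: pairwise_def orthogonal_def y_def)
  then have "norm (\<Sum>j\<in>I. y j) = sqrt (\<Sum>j\<in>I. (norm (x j))\<^sup>2)"
    by (simp add: y_def norm_scaleL2 real_sqrt_unique)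
  finally show ?thesis .
qed

lemma orthogonal_l1_uncond:
  fixes x :: "nat \<Rightarrow> 'k::{real_normed_field, euclidean_space} L2"
  assumes orth: "\<And>i j c d. i \<noteq> j \<Longrightarrow> scaleL2 c (x i) \<bullet> scaleL2 d (x j) = 0"
    and sq: "summable (\<lambda>j. (norm (x j))\<^sup>2)"
  shows "x \<in> l1_uncond scaleL2"
proof -
  have le: "(\<Sum>i<M. norm (\<phi> (x (k + i)))) \<le> onorm \<phi> * sqrt (\<Sum>j. (norm (x (j + k)))\<^sup>2)"
    if \<phi>: "\<phi> \<in> dual_space scaleL2" for \<phi> M k
  proof -
    have "(\<Sum>i<M. norm (\<phi> (x (k + i)))) \<le> onorm \<phi> * sqrt (\<Sum>i<M. (norm (x (k + i)))\<^sup>2)"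
      using orth by (intro sum_norm_functional_orthogonal_le \<phi>) auto
    also have "\<dots> \<le> onorm \<phi> * sqrt (\<Sum>j. (norm (x (j + k)))\<^sup>2)"
      using onorm_pos_le[of \<phi>] \<phi> sum_le_suminf[OF summable_ignore_initial_segment[OF sq, of k], of "{..<M}"]
      by (intro mult_left_mono real_sqrt_le_mono) (auto simp: dual_space_def add.commute)
    finally show ?thesis .
  qed
  have "x \<in> l1_weak scaleL2"
    unfolding l1_weak_def l1_seq_def
  proof (intro CollectI ballI)
    fix \<phi> :: "'k L2 \<Rightarrow> 'k" assume "\<phi> \<in> dual_space scaleL2"
    from le[OF this, of 0] show "summable (\<lambda>j. norm (\<phi> (x j)))"
      by (intro bounded_imp_summable[where B = "onorm \<phi> * sqrt (\<Sum>j. (norm (x j))\<^sup>2)"])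
        (simp_all add: lessThan_Suc_atMost[symmetric] del: sum.lessThan_Suc)
  qed
  moreover have "(\<lambda>k. weak_norm scaleL2 (\<lambda>j. x (k + j))) \<longlonglongrightarrow> 0"
  proof (rule tendsto_sandwich[OF _ _ tendsto_const])
    have "(\<lambda>k. sqrt (\<Sum>j. (norm (x (j + k)))\<^sup>2)) \<longlonglongrightarrow> sqrt 0"
      using suminf_exist_split2[OF sq] by (intro tendsto_real_sqrt)
    then have "(\<lambda>k. ennreal (sqrt (\<Sum>j. (norm (x (j + k)))\<^sup>2))) \<longlonglongrightarrow> ennreal 0"
      by (intro tendsto_ennrealI) simp
    then show "(\<lambda>k. ennreal (sqrt (\<Sum>j. (norm (x (j + k)))\<^sup>2))) \<longlonglongrightarrow> 0"
      by simp
    show "\<forall>\<^sub>F k in sequentially. weak_norm scaleL2 (\<lambda>j. x (k + j)) \<le>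
        ennreal (sqrt (\<Sum>j. (norm (x (j + k)))\<^sup>2))"
    proof (intro always_eventually allI, unfold weak_norm_def, rule SUP_least)
      fix k and \<phi> :: "'k L2 \<Rightarrow> 'k"
      assume "\<phi> \<in> {\<phi> \<in> dual_space scaleL2. onorm \<phi> \<le> 1}"
      then have \<phi>: "\<phi> \<in> dual_space scaleL2" "onorm \<phi> \<le> 1" by auto
      show "(\<Sum>j. ennreal (norm (\<phi> (x (k + j))))) \<le> ennreal (sqrt (\<Sum>j. (norm (x (j + k)))\<^sup>2))"
        unfolding suminf_eq_SUP
      proof (rule SUP_least)
        fix M
        have "(\<Sum>i<M. norm (\<phi> (x (k + i)))) \<le> onorm \<phi> * sqrt (\<Sum>j. (norm (x (j + k)))\<^sup>2)"
          by (rule le[OF \<phi>(1)])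
        also have "\<dots> \<le> 1 * sqrt (\<Sum>j. (norm (x (j + k)))\<^sup>2)"
          using \<phi>(2) by (intro mult_right_mono real_sqrt_ge_zero suminf_nonneg
            summable_ignore_initial_segment[OF sq]) auto
        finally show "(\<Sum>i<M. ennreal (norm (\<phi> (x (k + i))))) \<le>
            ennreal (sqrt (\<Sum>j. (norm (x (j + k)))\<^sup>2))"
          by (simp add: sum_ennreal ennreal_leI)
      qed
    qed
  qed simp
  ultimately show ?thesis
    by (simp add: l1_uncond_def)
qed

text \<open>
  Because \<open>2\<^sup>k \<psi>\<^sub>k\<close> lies in the unit ball, a tail of \<open>\<Sum>\<^sub>j \<bar>\<psi>\<^sub>k(x\<^sub>j)\<bar>\<close> is at most \<open>2\<^sup>-\<^sup>k\<close>, and the double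
  sum over \<open>j\<close> and \<open>k\<close> converges.  Hence even the supremum over \<open>k\<close> of \<open>\<bar>\<psi>\<^sub>k(x\<^sub>j)\<bar>\<close> is summable
  in \<open>j\<close>.
\<close>

lemma summable_functionals_l1_uncond:
  fixes x :: "nat \<Rightarrow> 'k::{real_normed_field, euclidean_space} L2"
  assumes x: "x \<in> l1_uncond scaleL2" and dual: "\<And>k. \<psi> k \<in> dual_space scaleL2"
    and le: "\<And>k x. norm (\<psi> k x) \<le> (1/2) ^ k * norm x"
  obtains N \<sigma> where "summable \<sigma>" "\<And>j k. j \<ge> N \<Longrightarrow> norm (\<psi> k (x j)) \<le> \<sigma> j"
    "\<And>j. j \<ge> N \<Longrightarrow> norm (x j) \<le> 1"
proof -
  obtain N where N: "\<And>\<phi> M. \<phi> \<in> dual_space scaleL2 \<Longrightarrow> (\<And>y. norm (\<phi> y) \<le> norm y) \<Longrightarrow>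
    (\<Sum>j<M. norm (\<phi> (x (N + j)))) \<le> 1"
    using l1_uncond_tail[OF x] by metis
  define \<sigma> where "\<sigma> j = (\<Sum>k. norm (\<psi> k (x j)))" for j
  have geo: "summable (\<lambda>k. (1/2::real) ^ k)"
    by (rule summable_geometric) simp
  have sk: "summable (\<lambda>k. norm (\<psi> k y))" for y
    by (rule summable_comparison_test'[where g = "\<lambda>k. (1/2) ^ k * norm y"])
      (use le geo in \<open>auto intro: summable_mult2\<close>)
  have each: "(\<Sum>j<M. norm (\<psi> k (x (N + j)))) \<le> (1/2) ^ k" for k M
  proof -
    have "(\<Sum>j<M. norm (2 ^ k * \<psi> k (x (N + j)))) \<le> 1"
      using le[of k] by (intro N dual_space_const_mult dual)
        (auto simp: norm_mult norm_power field_simps power_divide)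
    then show ?thesis
      by (simp add: norm_mult norm_power field_simps power_divide flip: sum_distrib_left)
  qed
  have "summable (\<lambda>j. \<sigma> (j + N))"
  proof (rule bounded_imp_summable)
    fix M
    have "(\<Sum>j\<le>M. \<sigma> (j + N)) = (\<Sum>k. \<Sum>j<Suc M. norm (\<psi> k (x (N + j))))"
      unfolding \<sigma>_def lessThan_Suc_atMost add.commute[of N]
      by (rule suminf_sum[symmetric]) (rule sk)
    also have "\<dots> \<le> (\<Sum>k. (1/2) ^ k)"
      using each by (intro suminf_le geo summable_sum sk)
    finally show "(\<Sum>j\<le>M. \<sigma> (j + N)) \<le> (\<Sum>k. (1/2) ^ k)" .
  qed (auto simp: \<sigma>_def intro: suminf_nonneg sk)
  then have "summable \<sigma>"
    by (simp only: summable_iff_shift)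
  moreover have "norm (\<psi> k (x j)) \<le> \<sigma> j" for j k
    unfolding \<sigma>_def using sum_le_suminf[OF sk[of "x j"], of "{k}"] by simp
  moreover have "norm (x j) \<le> 1" if "j \<ge> N" for j
  proof (rule norm_le_1_of_functionals_le_1)
    fix \<phi> :: "'k L2 \<Rightarrow> 'k"
    assume \<phi>: "\<phi> \<in> dual_space scaleL2" "\<And>y. norm (\<phi> y) \<le> norm y"
    have "norm (\<phi> (x j)) \<le> (\<Sum>i<Suc (j - N). norm (\<phi> (x (N + i))))"
      using that by (simp add: sum_nonneg)
    also have "\<dots> \<le> 1"
      by (rule N[OF \<phi>])
    finally show "norm (\<phi> (x j)) \<le> 1" .
  qed
  ultimately show thesis
    by (rule that)
qed

section \<open>Multiplication by step functions\<close>

text \<open>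
  Any measurable map from the interval to the natural numbers serves, provided that each of its
  fibres contains a nondegenerate interval.  The fibre of this one over \<open>k\<close> contains the points
  between \<open>1/(k + 2)\<close> and \<open>1/(k + 1)\<close>.
\<close>

definition slab :: "real \<Rightarrow> nat"
  where "slab t = nat \<lfloor>1 / t\<rfloor> - 1"

lemma slab_eq:
  assumes "1 / real (k + 2) < t" "t \<le> 1 / real (k + 1)"
  shows "slab t = k"
proof -
  have t: "t > 0"
    using assms(1) by (rule le_less_trans[rotated]) simp
  have "\<lfloor>1 / t\<rfloor> = int (k + 1)"
    using assms t by (intro floor_unique) (auto simp: field_simps)
  then show ?thesis
    by (simp add: slab_def)
qed

lemma slab_measurable: "(\<lambda>t. c (slab t)) \<in> borel_measurable Leb"
proof -
  have "(\<lambda>t::real. \<lfloor>1 / t\<rfloor>) \<in> borel \<rightarrow>\<^sub>M count_space UNIV"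
    by (rule measurable_compose[OF _ measurable_real_floor]) simp
  then have "(\<lambda>t::real. c (nat \<lfloor>1 / t\<rfloor> - 1)) \<in> borel_measurable borel"
    by (rule measurable_compose) simp
  then show ?thesis
    unfolding slab_def
    by (intro measurable_restrict_space1 measurable_completion) simp
qed

lemma integrable_slab_mult:
  fixes c :: "nat \<Rightarrow> 'k::{real_normed_field, euclidean_space}"
  assumes "bounded (range c)" "sq_integrable f"
  shows "integrable Leb (\<lambda>t. c (slab t) * f t)"
proof -
  obtain B where B: "norm (c k) \<le> B" for k
    using assms(1) by (auto simp: bounded_iff)
  have "sq_integrable (\<lambda>t. c (slab t))"
    by (rule bounded_sq_integrable[OF slab_measurable B])
  from sq_integrable_times_integrable[OF this assms(2)] show ?thesis .
qed

text \<open>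
  Multiplication by the step function that takes the value \<open>c\<^sub>k\<close> on the \<open>k\<close>-th slab.  Unbounded
  sequences are sent to zero, since they need not map into \<open>L\<^sub>1\<close>.
\<close>

lift_definition slab_mult ::
    "(nat \<Rightarrow> 'k) \<Rightarrow> 'k L2 \<Rightarrow> 'k::{real_normed_field, euclidean_space} L1"
  is "\<lambda>c f. if bounded (range c) then (\<lambda>t. c (slab t) * f t) else (\<lambda>t. 0)"
  by (auto simp: L1_rel_def L2_rel_def integrable_slab_mult)

lemma slab_mult_add_right: "slab_mult c (f + g) = slab_mult c f + slab_mult c g"
  by transfer (auto simp: L1_rel_def L2_rel_def integrable_slab_mult sq_integrable_add distrib_left)

lemma slab_mult_scale_right: "slab_mult c (scaleL2 a f) = scaleL1 a (slab_mult c f)"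
  by transfer (auto simp: L1_rel_def L2_rel_def integrable_slab_mult sq_integrable_mult_const mult.left_commute)

lemma slab_mult_add_left:
  assumes "bounded (range c)" "bounded (range d)"
  shows "slab_mult (\<lambda>k. c k + d k) f = slab_mult c f + slab_mult d f"
  using assms bounded_plus_comp[OF assms]
  by transfer (auto simp: L1_rel_def L2_rel_def integrable_slab_mult distrib_right)

lemma slab_mult_scale_left:
  assumes "bounded (range c)"
  shows "slab_mult (\<lambda>k. a * c k) f = scaleL1 a (slab_mult c f)"
proof -
  have "bounded (range (\<lambda>k. a * c k))"
    using bounded_linear_image[OF assms bounded_linear_mult_right[of a]] by (simp add: image_image)
  then show ?thesis
    using assms by transfer (auto simp: L1_rel_def L2_rel_def integrable_slab_mult mult.assoc)
qed

lemma slab_mult_zero_left [simp]: "slab_mult (\<lambda>k. 0) f = 0"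
  by transfer (auto simp: L1_rel_def)

lemma norm_slab_mult_le:
  fixes f :: "'k::{real_normed_field, euclidean_space} L2"
  assumes "\<And>k. norm (c k) \<le> B"
  shows "norm (slab_mult c f) \<le> B * sqrt (2 * pi) * norm f"
proof -
  have bdd: "bounded (range c)"
    using assms by (auto simp: bounded_iff)
  have B: "B \<ge> 0"
    using order_trans[OF norm_ge_zero assms[of 0]] .
  show ?thesis
  proof (transfer fixing: c B, unfold L2_rel_def)
    fix f :: "real \<Rightarrow> 'k"
    assume "sq_integrable f \<and> sq_integrable f \<and> (AE t in Leb. f t = f t)"
    then have f: "sq_integrable f" by simp
    have one: "sq_integrable (\<lambda>t. of_real B :: 'k)"
      by (rule bounded_sq_integrable[where B = B]) (use B in auto)
    have "(\<integral>t. norm (c (slab t) * f t) \<partial>Leb) \<le> (\<integral>t. norm (of_real B :: 'k) * norm (f t) \<partial>Leb)"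
      using integrable_norm[OF integrable_slab_mult[OF bdd f]] sq_integrable_mult[OF one f] assms B
      by (intro integral_mono) (auto simp: norm_mult intro: mult_right_mono)
    also note sq_integrable_Cauchy_Schwarz[OF one f]
    also have "sqrt (\<integral>t. (norm (of_real B :: 'k))\<^sup>2 \<partial>Leb) = B * sqrt (2 * pi)"
      using B by (simp add: measure_restrict_space real_sqrt_mult)
    finally show "(\<integral>t. norm ((if bounded (range c) then (\<lambda>t. c (slab t) * f t) else (\<lambda>t. 0)) t) \<partial>Leb) \<le>
        B * sqrt (2 * pi) * sqrt (\<integral>t. (norm (f t))\<^sup>2 \<partial>Leb)"
      using bdd by simp
  qed
qed

text \<open>
  The multiplication is jointly continuous in the supremum norm of the coefficients and the
  \<open>L\<^sub>2\<close> norm.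
\<close>

lemma slab_mult_tendsto:
  fixes c :: "'a \<Rightarrow> nat \<Rightarrow> 'k::{real_normed_field, euclidean_space}"
  assumes c: "uniform_limit UNIV c c0 F" and bdd: "\<And>v. bounded (range (c v))" "bounded (range c0)"
    and f: "(f \<longlongrightarrow> f0) F"
  shows "((\<lambda>v. slab_mult (c v) (f v)) \<longlongrightarrow> slab_mult c0 f0) F"
proof (rule Lim_transform2[OF tendsto_const], rule tendstoI)
  fix e :: real assume e: "e > 0"
  obtain B where B: "norm (c0 k) \<le> B" for k
    using bdd(2) by (auto simp: bounded_iff)
  have Bnn: "B \<ge> 0"
    using order_trans[OF norm_ge_zero B[of 0]] .
  define K where "K = sqrt (2 * pi)"
  have K: "K > 0" by (simp add: K_def)
  \<comment> \<open>If both arguments are \<open>d\<close>-close to their limits, the products differ by at most \<open>K (B + \<parallel>f0\<parallel> + 1) d\<close>.\<close>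
  define d where "d = min 1 (e / (2 * K * (B + norm f0 + 1)))"
  have d: "d > 0" "d \<le> 1"
    using e K Bnn by (auto simp: d_def add_nonneg_pos)
  have L: "B + norm f0 + 1 > 0"
    using Bnn by (simp add: add_nonneg_pos)
  have "K * (B + norm f0 + 1) * d \<le> K * (B + norm f0 + 1) * (e / (2 * K * (B + norm f0 + 1)))"
    using K Bnn by (intro mult_left_mono) (auto simp: d_def)
  also have "\<dots> = e / 2"
    using K L by (simp del: distrib_left_numeral)
  finally have de: "K * (B + norm f0 + 1) * d \<le> e / 2" .
  have "\<forall>\<^sub>F v in F. \<forall>k\<in>UNIV. dist (c v k) (c0 k) < d"
    using uniform_limitD[OF c d(1)] .
  moreover have "\<forall>\<^sub>F v in F. dist (f v) f0 < d"
    using tendstoD[OF f d(1)] .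
  ultimately show "\<forall>\<^sub>F v in F. dist (slab_mult c0 f0 - slab_mult (c v) (f v)) 0 < e"
  proof eventually_elim
    case (elim v)
    let ?h = "\<lambda>k. c v k + - c0 k"
    have h: "norm (?h k) \<le> d" for k
      using elim(1) by (simp add: dist_norm less_imp_le)
    have cv: "norm (c v k) \<le> B + 1" for k
      using h[of k] B[of k] d norm_triangle_ineq[of "c v k - c0 k" "c0 k"] by simp
    have "slab_mult (c v) f0 = slab_mult (\<lambda>k. c0 k + ?h k) f0"
      by simp
    also have "\<dots> = slab_mult c0 f0 + slab_mult ?h f0"
      by (rule slab_mult_add_left) (use bdd(2) h in \<open>auto simp: bounded_iff\<close>)
    finally have 1: "slab_mult (c v) f0 = slab_mult c0 f0 + slab_mult ?h f0" .
    have "slab_mult (c v) (f v) = slab_mult (c v) (f0 + (f v - f0))"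
      by simp
    also have "\<dots> = slab_mult c0 f0 + slab_mult ?h f0 + slab_mult (c v) (f v - f0)"
      by (simp only: slab_mult_add_right 1)
    finally have "slab_mult c0 f0 - slab_mult (c v) (f v) =
        - (slab_mult ?h f0 + slab_mult (c v) (f v - f0))"
      by simp
    then have "norm (slab_mult c0 f0 - slab_mult (c v) (f v)) \<le>
        norm (slab_mult ?h f0) + norm (slab_mult (c v) (f v - f0))"
      by (simp only: norm_minus_cancel norm_triangle_ineq)
    also have "\<dots> \<le> d * K * norm f0 + (B + 1) * K * norm (f v - f0)"
      unfolding K_def by (intro add_mono norm_slab_mult_le h cv)
    also have "\<dots> \<le> d * K * norm f0 + (B + 1) * K * d"
      using elim(2) Bnn K by (intro add_left_mono mult_left_mono) (auto simp: dist_norm)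
    also have "\<dots> = K * (B + norm f0 + 1) * d"
      by (simp add: algebra_simps)
    finally show ?case
      using de e by simp
  qed
qed

section \<open>The polynomial and its summing set\<close>

lemma norm_power_diff_le:
  fixes z w :: "'a::real_normed_field"
  assumes "norm z \<le> R" "norm w \<le> R" "1 \<le> R"
  shows "norm (z ^ m - w ^ m) \<le> m * R ^ m * norm (z - w)"
proof (induction m)
  case (Suc m)
  have "z ^ Suc m - w ^ Suc m = z * (z ^ m - w ^ m) + (z - w) * w ^ m"
    by (simp add: algebra_simps)
  then have "norm (z ^ Suc m - w ^ Suc m) \<le> norm z * norm (z ^ m - w ^ m) + norm (z - w) * norm w ^ m"
    by (metis norm_mult norm_power norm_triangle_ineq)
  also have "\<dots> \<le> R * (m * R ^ m * norm (z - w)) + norm (z - w) * R ^ Suc m"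
  proof (intro add_mono mult_mono Suc.IH)
    have "norm w ^ m \<le> R ^ m"
      using assms by (intro power_mono) auto
    also have "\<dots> \<le> R ^ Suc m"
      using assms by (intro power_increasing) auto
    finally show "norm w ^ m \<le> R ^ Suc m" .
  qed (use assms in auto)
  also have "\<dots> = Suc m * R ^ Suc m * norm (z - w)"
    by (simp add: algebra_simps)
  finally show ?case .
qed simp

text \<open>
  The underlying multilinear map sends \<open>(v\<^sub>0, \<dots>, v\<^sub>m)\<close> to \<open>v\<^sub>0\<close> multiplied on the \<open>k\<close>-th slab by
  \<open>\<psi>\<^sub>k(v\<^sub>1) \<cdots> \<psi>\<^sub>k(v\<^sub>m)\<close>.  The functionals \<open>\<psi>\<^sub>k\<close> are equicontinuous, so these products converge
  uniformly in \<open>k\<close>, which is what continuity of the multiplication asks for.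
\<close>

lemma cont_hom_poly_slab_mult_power:
  fixes \<psi> :: "nat \<Rightarrow> 'k::{real_normed_field, euclidean_space} L2 \<Rightarrow> 'k"
  assumes dual: "\<And>k. \<psi> k \<in> dual_space scaleL2"
    and le: "\<And>k x. norm (\<psi> k x) \<le> norm x"
  shows "cont_hom_poly scaleL2 scaleL1 (Suc m) (\<lambda>x. slab_mult (\<lambda>k. \<psi> k x ^ m) x)"
proof -
  define P where "P v k = (\<Prod>i\<in>{1..m}. \<psi> k (v i))" for v k
  define A where "A v = slab_mult (P v) (v 0)" for v
  have bdd_prod: "bounded (range (\<lambda>k. \<Prod>i\<in>I. \<psi> k (v i)))" for v I
    unfolding bounded_iff
    by (intro exI[of _ "\<Prod>i\<in>I. norm (v i)"])
      (auto simp: prod_norm[symmetric] intro!: prod_mono le)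
  have "n_linear scaleL2 scaleL1 (Suc m) A"
    unfolding n_linear_def
  proof (intro ballI allI impI)
    fix v :: "nat \<Rightarrow> 'k L2" and i assume i: "i < Suc m"
    show "Vector_Spaces.linear scaleL2 scaleL1 (\<lambda>x. A (v(i := x)))"
    proof (cases "i = 0")
      case True
      have "A (v(i := x)) = slab_mult (P v) x" for x
        using True by (auto simp: A_def P_def intro!: arg_cong2[of _ _ _ _ slab_mult] prod.cong)
      then show ?thesis
        by (simp add: Vector_Spaces.linear_def vector_space_scaleL2 vector_space_scaleL1
            module_hom_def module_hom_axioms_def module_iff_vector_space slab_mult_add_right slab_mult_scale_right)
    next
      case False
      define R where "R k = (\<Prod>j\<in>{1..m} - {i}. \<psi> k (v j))" for k
      have R: "(\<Prod>j\<in>insert i ({1..m} - {i}). \<psi> k ((v(i := x)) j)) = \<psi> k x * R k" for x k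
        by (subst prod.insert) (auto simp: R_def intro!: prod.cong)
      have bdd: "bounded (range (\<lambda>k. \<psi> k x * R k))" for x
        using bdd_prod[of "v(i := x)" "insert i ({1..m} - {i})"] unfolding R .
      have "P (v(i := x)) k = \<psi> k x * R k" for x k
      proof -
        have "{1..m} = insert i ({1..m} - {i})"
          using False i by auto
        then have "P (v(i := x)) k = (\<Prod>j\<in>insert i ({1..m} - {i}). \<psi> k ((v(i := x)) j))"
          unfolding P_def by simp
        then show ?thesis
          unfolding R .
      qed
      then have "A (v(i := x)) = slab_mult (\<lambda>k. \<psi> k x * R k) (v 0)" for x
        using False by (auto simp: A_def intro!: arg_cong2[of _ _ _ _ slab_mult])
      then show ?thesis
        by (simp add: Vector_Spaces.linear_def vector_space_scaleL2 vector_space_scaleL1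
            module_hom_def module_hom_axioms_def module_iff_vector_space dual_space_add[OF dual]
            dual_space_scale[OF dual] distrib_right mult.assoc slab_mult_add_left slab_mult_scale_left bdd)
    qed
  qed
  moreover have "continuous_on ({..<Suc m} \<rightarrow>\<^sub>E UNIV) A"
    unfolding continuous_on_def
  proof
    fix a :: "nat \<Rightarrow> 'k L2"
    let ?F = "at a within ({..<Suc m} \<rightarrow>\<^sub>E UNIV)"
    have coord: "((\<lambda>v. v i) \<longlongrightarrow> a i) ?F" for i
    proof -
      have "((\<lambda>v. v i) \<longlongrightarrow> a i) (at a within UNIV)"
        using continuous_on_product_coordinates[of i] unfolding continuous_on_def by blast
      then show ?thesis
        by (rule tendsto_within_subset) simp
    qed
    have "uniform_limit UNIV (\<lambda>v k. \<Prod>i\<in>I. \<psi> k (v i)) (\<lambda>k. \<Prod>i\<in>I. \<psi> k (a i)) ?F"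
      if "finite I" for I
      using that
    proof (induction I)
      case (insert i I)
      have "uniform_limit UNIV (\<lambda>v k. \<psi> k (v i)) (\<lambda>k. \<psi> k (a i)) ?F"
      proof (rule uniform_limitI)
        fix e :: real assume "e > 0"
        from tendstoD[OF coord[of i] this]
        show "\<forall>\<^sub>F v in ?F. \<forall>k\<in>UNIV. dist (\<psi> k (v i)) (\<psi> k (a i)) < e"
          by eventually_elim
            (use le in \<open>auto simp: dist_norm simp flip: dual_space_diff[OF dual] intro: le_less_trans\<close>)
      qed
      then have "uniform_limit UNIV (\<lambda>v k. \<psi> k (v i) * (\<Prod>i\<in>I. \<psi> k (v i)))
          (\<lambda>k. \<psi> k (a i) * (\<Prod>i\<in>I. \<psi> k (a i))) ?F"
        using insert.IH bdd_prod[of "a" "{i}"] bdd_prod[of a I]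
        by (intro uniform_lim_mult) auto
      then show ?case
        using insert.hyps by simp
    qed (simp add: uniform_limit_const)
    then show "(A \<longlongrightarrow> A a) ?F"
      unfolding A_def P_def by (intro slab_mult_tendsto coord bdd_prod) auto
  qed
  moreover have "slab_mult (\<lambda>k. \<psi> k x ^ m) x = A (\<lambda>i\<in>{..<Suc m}. x)" for x
    by (auto simp: A_def P_def intro!: arg_cong2[of _ _ _ _ slab_mult])
  ultimately show ?thesis
    unfolding cont_hom_poly_def by blast
qed

lemma half_power_mult_le: "0 \<le> r \<Longrightarrow> (1/2) ^ k * r \<le> (r :: real)"
  using mult_right_mono[of "(1/2 :: real) ^ k" 1 r] by (simp add: power_le_one)

text \<open>
  Only one part of the increment matters.  With \<open>c\<^sub>a\<close> the sequence \<open>k \<mapsto> \<psi>\<^sub>k(a)\<^sup>m\<close>, the increment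
  at \<open>x\<^sub>j\<close> is \<open>c\<^sub>a\<close> times \<open>x\<^sub>j\<close> plus the remainder \<open>c\<^sub>a\<^sub>+\<^sub>x - c\<^sub>a\<close> times \<open>a + x\<^sub>j\<close> (where
  \<open>x = x\<^sub>j\<close>).  The remainder is always absolutely summable: its norm is at most a constant times
  the supremum over \<open>k\<close> of \<open>\<bar>\<psi>\<^sub>k(x\<^sub>j)\<bar>\<close>.  So the polynomial is summing at \<open>a\<close> precisely if
  multiplication by \<open>c\<^sub>a\<close> is a summing operator.
\<close>

lemma one_summing_at_slab_mult_power_iff:
  fixes \<psi> :: "nat \<Rightarrow> 'k::{real_normed_field, euclidean_space} L2 \<Rightarrow> 'k"
  assumes dual: "\<And>k. \<psi> k \<in> dual_space scaleL2"
    and le: "\<And>k x. norm (\<psi> k x) \<le> (1/2) ^ k * norm x"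
  shows "one_summing_at scaleL2 (\<lambda>x. slab_mult (\<lambda>k. \<psi> k x ^ m) x) a \<longleftrightarrow>
    (\<forall>x\<in>l1_uncond scaleL2. (\<lambda>j. slab_mult (\<lambda>k. \<psi> k a ^ m) (x j)) \<in> l1_seq)"
  unfolding one_summing_at_def
proof (rule ball_cong[OF refl])
  fix x :: "nat \<Rightarrow> 'k L2" assume x: "x \<in> l1_uncond scaleL2"
  let ?h = "\<lambda>j k. \<psi> k (a + x j) ^ m + - (\<psi> k a ^ m)"
  define y where "y j = slab_mult (?h j) (a + x j)" for j
  have le1: "norm (\<psi> k z) \<le> norm z" for k z
    by (rule order_trans[OF le half_power_mult_le]) simp
  have bdd: "bounded (range (\<lambda>k. \<psi> k z ^ m))" for z
    unfolding bounded_iff by (intro exI[of _ "norm z ^ m"]) (auto simp: norm_power power_mono le1)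
  have bdd': "bounded (range (\<lambda>k. - (\<psi> k z ^ m)))" for z
    using bdd[of z] by (auto simp: bounded_iff)
  have split: "slab_mult (\<lambda>k. \<psi> k (a + x j) ^ m) (a + x j) - slab_mult (\<lambda>k. \<psi> k a ^ m) a =
      slab_mult (\<lambda>k. \<psi> k a ^ m) (x j) + y j" for j
  proof -
    have "slab_mult (\<lambda>k. \<psi> k (a + x j) ^ m) (a + x j) = slab_mult (\<lambda>k. \<psi> k a ^ m + ?h j k) (a + x j)"
      by simp
    also have "\<dots> = slab_mult (\<lambda>k. \<psi> k a ^ m) (a + x j) + y j"
      unfolding y_def by (intro slab_mult_add_left bdd bounded_plus_comp bdd')
    finally show ?thesis
      by (simp add: slab_mult_add_right)
  qed
  obtain \<sigma> N where \<sigma>: "summable \<sigma>" "\<And>j k. j \<ge> N \<Longrightarrow> norm (\<psi> k (x j)) \<le> \<sigma> j"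
    and N: "\<And>j. j \<ge> N \<Longrightarrow> norm (x j) \<le> 1"
    by (rule summable_functionals_l1_uncond[OF x dual le]) (rule that, auto)
  define R where "R = norm a + 1"
  have "summable (\<lambda>j. norm (y j))"
  proof (rule summable_comparison_test')
    show "summable (\<lambda>j. m * R ^ m * \<sigma> j * (sqrt (2 * pi) * R))"
      by (intro summable_mult summable_mult2 \<sigma>)
    fix j assume j: "j \<ge> N"
    have ax: "norm (a + x j) \<le> R"
      using N[OF j] norm_triangle_ineq[of a "x j"] by (simp add: R_def)
    have h: "norm (?h j k) \<le> m * R ^ m * \<sigma> j" for k
    proof -
      have "norm (\<psi> k (a + x j) ^ m - \<psi> k a ^ m) \<le> m * R ^ m * norm (\<psi> k (a + x j) - \<psi> k a)"
        using le1[of k "a + x j"] le1[of k a] ax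
        by (intro norm_power_diff_le) (auto simp: R_def)
      also have "\<dots> \<le> m * R ^ m * \<sigma> j"
        using \<sigma>(2)[OF j, of k] by (intro mult_left_mono) (auto simp: dual_space_add[OF dual] R_def)
      finally show ?thesis by simp
    qed
    have nn: "0 \<le> m * R ^ m * \<sigma> j"
      using order_trans[OF norm_ge_zero h] .
    have "norm (y j) \<le> m * R ^ m * \<sigma> j * sqrt (2 * pi) * norm (a + x j)"
      unfolding y_def by (rule norm_slab_mult_le[OF h])
    also have "\<dots> \<le> m * R ^ m * \<sigma> j * sqrt (2 * pi) * R"
      by (intro mult_left_mono[OF ax] mult_nonneg_nonneg[OF nn]) simp
    finally show "norm (norm (y j)) \<le> m * R ^ m * \<sigma> j * (sqrt (2 * pi) * R)"
      by (simp add: mult.assoc)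
  qed
  then have y: "y \<in> l1_seq"
    by (simp add: l1_seq_def)
  have plus: "(\<lambda>j. u j + w j) \<in> l1_seq" if "u \<in> l1_seq" "w \<in> l1_seq" for u w :: "nat \<Rightarrow> 'k L1"
    using that unfolding l1_seq_def
    by (auto intro!: summable_comparison_test'[OF summable_add, of "\<lambda>j. norm (u j)" "\<lambda>j. norm (w j)"]
        norm_triangle_ineq)
  have "(\<lambda>j. - y j) \<in> l1_seq"
    using y by (simp add: l1_seq_def)
  then show "(\<lambda>j. slab_mult (\<lambda>k. \<psi> k (a + x j) ^ m) (a + x j) - slab_mult (\<lambda>k. \<psi> k a ^ m) a) \<in> l1_seq
      \<longleftrightarrow> (\<lambda>j. slab_mult (\<lambda>k. \<psi> k a ^ m) (x j)) \<in> l1_seq"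
    unfolding split using y plus[of "\<lambda>j. slab_mult (\<lambda>k. \<psi> k a ^ m) (x j)" y]
      plus[of "\<lambda>j. slab_mult (\<lambda>k. \<psi> k a ^ m) (x j) + y j" "\<lambda>j. - y j"] by auto
qed

section \<open>Multiplication operators that are not summing\<close>

lemma integral_Leb_interval_FTC:
  fixes f F :: "real \<Rightarrow> real"
  assumes "- pi \<le> p" "p \<le> q" "q \<le> pi"
    and F: "\<And>t. (F has_real_derivative f t) (at t)" and f: "continuous_on UNIV f"
  shows "integrable Leb (\<lambda>t. indicator {p..q} t * f t)"
    and "(\<integral>t. indicator {p..q} t * f t \<partial>Leb) = F q - F p"
proof -
  have eq: "indicator {-pi..pi} t *\<^sub>R (indicator {p..q} t * f t) = indicator {p..q} t *\<^sub>R f t" for t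
    using assms(1-3) by (auto simp: indicator_def)
  have has: "has_bochner_integral lborel (\<lambda>t. indicator {p..q} t *\<^sub>R f t) (F q - F p)"
    using assms(2) F continuous_on_subset[OF f]
    by (intro has_bochner_integral_FTC_Icc)
      (auto simp: has_real_derivative_iff_has_vector_derivative intro: has_vector_derivative_at_within)
  then have "has_bochner_integral lebesgue (\<lambda>t. indicator {p..q} t *\<^sub>R f t) (F q - F p)"
    by (auto simp: has_bochner_integral_iff integrable_completion integral_completion)
  then show "integrable Leb (\<lambda>t. indicator {p..q} t * f t)"
    and "(\<integral>t. indicator {p..q} t * f t \<partial>Leb) = F q - F p"
    by (simp_all add: integrable_restrict_space integral_restrict_space eq has_bochner_integral_iff
        del: real_scaleR_def)
qed

lemma sin_times_sin_orthogonal: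
  assumes "m > 0" "n > 0" "m \<noteq> n"
  shows "(\<integral>t. sin (real m * t) * sin (real n * t) \<partial>Leb) = 0"
proof -
  define a b where "a = real m - real n" and "b = real m + real n"
  have ab: "a \<noteq> 0" "b \<noteq> 0"
    using assms by (auto simp: a_def b_def)
  define F where "F t = sin (a * t) / (2 * a) - sin (b * t) / (2 * b)" for t
  have "(F has_real_derivative sin (real m * t) * sin (real n * t)) (at t)" for t
  proof -
    have "(F has_real_derivative cos (a * t) / 2 - cos (b * t) / 2) (at t)"
      unfolding F_def using ab by (auto intro!: derivative_eq_intros)
    also have "cos (a * t) / 2 - cos (b * t) / 2 = sin (real m * t) * sin (real n * t)"
      by (simp add: sin_times_sin a_def b_def algebra_simps diff_divide_distrib)
    finally show ?thesis .
  qed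
  then have "(\<integral>t. indicator {-pi..pi} t * (sin (real m * t) * sin (real n * t)) \<partial>Leb) = F pi - F (-pi)"
    by (intro integral_Leb_interval_FTC(2)) (auto intro!: continuous_intros)
  also have "F pi - F (-pi) = 0"
  proof -
    have "sin (a * pi) = 0" "sin (b * pi) = 0"
      unfolding a_def b_def using sin_npi_int[of "int m - int n"] sin_npi_int[of "int m + int n"]
      by (simp_all add: mult.commute)
    then show ?thesis
      by (simp add: F_def)
  qed
  also have "(\<integral>t. indicator {-pi..pi} t * (sin (real m * t) * sin (real n * t)) \<partial>Leb) =
      (\<integral>t. sin (real m * t) * sin (real n * t) \<partial>Leb)"
    by (intro Bochner_Integration.integral_cong) auto
  finally show ?thesis .
qed

text \<open>
  Orthogonality and the factor \<open>1/(j + 1)\<close> make the sequence unconditionally summable in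
  \<open>L\<^sub>2\<close>, although its \<open>L\<^sub>1\<close> norms over any interval decay only like \<open>1/(j + 1)\<close>.
\<close>

lift_definition sine_L2 :: "nat \<Rightarrow> 'k::{real_normed_field, euclidean_space} L2"
  is "\<lambda>j t. of_real (sin (real (Suc j) * t) / real (Suc j))"
proof -
  fix j
  have "sq_integrable (\<lambda>t. of_real (sin (real (Suc j) * t) / real (Suc j)) :: 'k)"
  proof (rule bounded_sq_integrable[where B = "1 / real (Suc j)"])
    have "(\<lambda>t. of_real (sin (real (Suc j) * t) / real (Suc j)) :: 'k) \<in> borel_measurable borel"
      by measurable
    then show "(\<lambda>t. of_real (sin (real (Suc j) * t) / real (Suc j)) :: 'k) \<in> borel_measurable Leb"
      by (intro measurable_restrict_space1 measurable_completion) simp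
    show "norm (of_real (sin (real (Suc j) * t) / real (Suc j)) :: 'k) \<le> 1 / real (Suc j)" for t
      unfolding norm_of_real by (simp add: divide_right_mono)
  qed
  then show "L2_rel (\<lambda>t. of_real (sin (real (Suc j) * t) / real (Suc j)) :: 'k)
      (\<lambda>t. of_real (sin (real (Suc j) * t) / real (Suc j)))"
    by (simp add: L2_rel_def)
qed

lemma sine_L2_orthogonal:
  fixes c d :: "'k::{real_normed_field, euclidean_space}"
  assumes "i \<noteq> j"
  shows "scaleL2 c (sine_L2 i) \<bullet> scaleL2 d (sine_L2 j) = 0"
proof (transfer fixing: c d i j)
  have "(\<integral>t. (c * of_real (sin (real (Suc i) * t) / real (Suc i))) \<bullet>
        (d * of_real (sin (real (Suc j) * t) / real (Suc j))) \<partial>Leb) =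
      (\<integral>t. (c \<bullet> d) / (real (Suc i) * real (Suc j)) *
        (sin (real (Suc i) * t) * sin (real (Suc j) * t)) \<partial>Leb)"
  proof (intro Bochner_Integration.integral_cong refl)
    fix t
    have "c * of_real u = u *\<^sub>R c" for c :: 'k and u
      by (simp add: scaleR_conv_of_real mult.commute)
    then show "(c * of_real (sin (real (Suc i) * t) / real (Suc i))) \<bullet>
        (d * of_real (sin (real (Suc j) * t) / real (Suc j))) =
      (c \<bullet> d) / (real (Suc i) * real (Suc j)) * (sin (real (Suc i) * t) * sin (real (Suc j) * t))"
      by (simp only: inner_scaleR_left inner_scaleR_right) (simp add: field_simps)
  qed
  also have "\<dots> = 0"
    using sin_times_sin_orthogonal[of "Suc i" "Suc j"] assms by simp
  finally show "(\<integral>t. (c * of_real (sin (real (Suc i) * t) / real (Suc i))) \<bullet>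
        (d * of_real (sin (real (Suc j) * t) / real (Suc j))) \<partial>Leb) = 0" .
qed

lemma norm_sine_L2_le: "(norm (sine_L2 j :: 'k::{real_normed_field, euclidean_space} L2))\<^sup>2 \<le>
  2 * pi * (1 / real (Suc j))\<^sup>2"
proof transfer
  fix j
  interpret finite_measure Leb
    by (rule finite_measure_lebesgue_on) auto
  have "(\<integral>t. (norm (of_real (sin (real (Suc j) * t) / real (Suc j)) :: 'k))\<^sup>2 \<partial>Leb) \<le>
      (\<integral>t. (1 / real (Suc j))\<^sup>2 \<partial>Leb)"
  proof (rule integral_mono')
    show "(norm (of_real (sin (real (Suc j) * t) / real (Suc j)) :: 'k))\<^sup>2 \<le> (1 / real (Suc j))\<^sup>2" for t
      unfolding norm_of_real by (intro power_mono) (simp_all add: divide_right_mono)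
  qed auto
  also have "\<dots> = 2 * pi * (1 / real (Suc j))\<^sup>2"
    by (simp add: measure_restrict_space)
  finally show "(sqrt (\<integral>t. (norm (of_real (sin (real (Suc j) * t) / real (Suc j)) :: 'k))\<^sup>2 \<partial>Leb))\<^sup>2 \<le>
      2 * pi * (1 / real (Suc j))\<^sup>2"
    by simp
qed

lemma sine_L2_l1_uncond: "sine_L2 \<in> l1_uncond scaleL2"
proof (rule orthogonal_l1_uncond[OF sine_L2_orthogonal])
  have "summable (\<lambda>j. 2 * pi * (1 / real (Suc j))\<^sup>2)"
    using inverse_squares_sums
    by (intro summable_mult) (simp add: sums_iff power_divide add.commute)
  then show "summable (\<lambda>j. (norm (sine_L2 j :: 'k::{real_normed_field, euclidean_space} L2))\<^sup>2)"
    by (rule summable_comparison_test') (use norm_sine_L2_le in auto)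
qed

text \<open>
  On an interval \<open>[p, q]\<close> inside the \<open>k\<close>-th slab the sines keep a definite share of their mass:
  \<open>\<integral> \<bar>sin(mt)\<bar> \<ge> \<integral> sin\<^sup>2(mt) = (q - p)/2 - O(1/m)\<close>, at least \<open>(q - p)/4\<close> for large \<open>m\<close>.
\<close>

lemma norm_slab_mult_sine_ge:
  fixes c :: "nat \<Rightarrow> 'k::{real_normed_field, euclidean_space}"
  assumes c: "bounded (range c)"
  obtains \<delta> N where "\<delta> > 0"
    and "\<And>j. j \<ge> N \<Longrightarrow> norm (c k) * \<delta> / real (Suc j) \<le> norm (slab_mult c (sine_L2 j))"
proof -
  define q where "q = 1 / real (k + 1)"
  have "1 / real (k + 2) < q"
    by (simp add: q_def field_simps)
  then obtain p where p: "1 / real (k + 2) < p" "p < q"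
    using dense by blast
  have "0 < p"
    using p(1) by (rule le_less_trans[rotated]) simp
  moreover have "q \<le> pi"
    using pi_gt3 by (simp add: q_def divide_le_eq) (smt (verit) mult_less_cancel_right2 of_nat_0_le_iff)
  ultimately have pq: "-pi \<le> p" "p \<le> q" "q \<le> pi"
    using p pi_gt3 by auto
  have slab: "slab t = k" if "t \<in> {p..q}" for t
    using that p by (intro slab_eq) (auto simp: q_def)
  have bound: "norm (c k) * ((q - p) / 4) / real (Suc j) \<le> norm (slab_mult c (sine_L2 j))"
    if j: "j \<ge> nat \<lceil>2 / (q - p)\<rceil>" for j
  proof -
    define m where "m = real (Suc j)"
    have m: "m > 0" "2 / (q - p) \<le> m"
      using j by (auto simp: m_def nat_le_iff ceiling_le_iff)
    define F where "F t = t / 2 - sin (2 * (m * t)) / (4 * m)" for t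
    have F: "(F has_real_derivative (sin (m * t))\<^sup>2) (at t)" for t
    proof -
      have "(F has_real_derivative 1 / 2 - cos (2 * (m * t)) / 2) (at t)"
        unfolding F_def using m(1) by (auto intro!: derivative_eq_intros)
      also have "1 / 2 - cos (2 * (m * t)) / 2 = (sin (m * t))\<^sup>2"
        by (simp only: cos_double_sin) (simp add: diff_divide_distrib)
      finally show ?thesis .
    qed
    note int = integral_Leb_interval_FTC[OF pq F]
    have int_sq: "integrable Leb (\<lambda>t. indicator {p..q} t * (sin (m * t))\<^sup>2)"
      by (rule int) (auto intro!: continuous_intros)
    \<comment> \<open>The size of \<open>m\<close> is chosen so that the oscillating terms take away at most half of the main term \<open>(q - p) / 2\<close>.\<close>
    have "(sin (2 * (m * q)) - sin (2 * (m * p))) / (4 * m) \<le> 2 / (4 * m)"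
      using m(1) abs_sin_le_one[of "2 * (m * q)"] abs_sin_le_one[of "2 * (m * p)"]
      by (intro divide_right_mono) linarith+
    also have "\<dots> \<le> (q - p) / 4"
      using m p by (simp add: field_simps)
    finally have "(q - p) / 4 \<le> F q - F p"
      by (simp add: F_def diff_divide_distrib)
    also have "\<dots> = (\<integral>t. indicator {p..q} t * (sin (m * t))\<^sup>2 \<partial>Leb)"
      by (rule int(2)[symmetric]) (auto intro!: continuous_intros)
    finally have "norm (c k) / m * ((q - p) / 4) \<le>
        norm (c k) / m * (\<integral>t. indicator {p..q} t * (sin (m * t))\<^sup>2 \<partial>Leb)"
      using m(1) by (intro mult_left_mono) auto
    also have "\<dots> = (\<integral>t. norm (c k) / m * (indicator {p..q} t * (sin (m * t))\<^sup>2) \<partial>Leb)"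
      by simp
    also have "\<dots> \<le> norm (slab_mult c (sine_L2 j))"
      unfolding m_def
    proof (transfer fixing: c k p q j)
      let ?s = "\<lambda>t. of_real (sin (real (Suc j) * t) / real (Suc j)) :: 'k"
      show "(\<integral>t. norm (c k) / real (Suc j) * (indicator {p..q} t * (sin (real (Suc j) * t))\<^sup>2) \<partial>Leb) \<le>
          (\<integral>t. norm ((if bounded (range c) then \<lambda>t. c (slab t) * ?s t else (\<lambda>t. 0)) t) \<partial>Leb)"
      proof (rule integral_mono)
        show "integrable Leb (\<lambda>t. norm (c k) / real (Suc j) * (indicator {p..q} t * (sin (real (Suc j) * t))\<^sup>2))"
          using int_sq by (simp add: m_def)
        have "sq_integrable ?s"
          using sine_L2.rsp by (auto simp: rel_fun_def L2_rel_def)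
        then show "integrable Leb (\<lambda>t. norm ((if bounded (range c) then \<lambda>t. c (slab t) * ?s t else (\<lambda>t. 0)) t))"
          using c integrable_slab_mult[OF c] by (simp only: if_True) (intro integrable_norm)
        fix t
        have "(sin (real (Suc j) * t))\<^sup>2 \<le> \<bar>sin (real (Suc j) * t)\<bar>"
          using power_le_one_iff abs_sin_le_one[of "real (Suc j) * t"] mult_left_le[of "\<bar>sin (real (Suc j) * t)\<bar>" "\<bar>sin (real (Suc j) * t)\<bar>"]
          by (simp add: power2_eq_square abs_mult_self_eq flip: abs_mult)
        then show "norm (c k) / real (Suc j) * (indicator {p..q} t * (sin (real (Suc j) * t))\<^sup>2) \<le>
            norm ((if bounded (range c) then \<lambda>t. c (slab t) * ?s t else (\<lambda>t. 0)) t)"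
          using c slab[of t] unfolding norm_mult norm_of_real if_P[OF c]
          by (auto simp: indicator_def norm_mult abs_divide divide_right_mono mult_left_mono)
      qed
    qed
    finally show ?thesis
      by (simp add: m_def field_simps)
  qed
  show thesis
    using p by (intro that[of "(q - p) / 4" "nat \<lceil>2 / (q - p)\<rceil>"] bound) auto
qed

text \<open>
  A nonzero multiplier maps the sine sequence to one whose norms dominate a multiple of the
  harmonic series.
\<close>

lemma slab_mult_summing_iff:
  fixes c :: "nat \<Rightarrow> 'k::{real_normed_field, euclidean_space}"
  assumes c: "bounded (range c)"
  shows "(\<forall>x\<in>l1_uncond scaleL2. (\<lambda>j. slab_mult c (x j)) \<in> l1_seq) \<longleftrightarrow> (\<forall>k. c k = 0)"
proof
  assume sum: "\<forall>x\<in>l1_uncond scaleL2. (\<lambda>j. slab_mult c (x j)) \<in> l1_seq"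
  show "\<forall>k. c k = 0"
  proof (rule ccontr)
    assume "\<not> (\<forall>k. c k = 0)"
    then obtain k where k: "c k \<noteq> 0" by blast
    obtain \<delta> N where \<delta>: "\<delta> > 0"
      and le: "\<And>j. j \<ge> N \<Longrightarrow> norm (c k) * \<delta> / real (Suc j) \<le> norm (slab_mult c (sine_L2 j))"
      using norm_slab_mult_sine_ge[OF c, of k] by metis
    have "summable (\<lambda>j. norm (slab_mult c (sine_L2 j)))"
      using sum sine_L2_l1_uncond by (auto simp: l1_seq_def)
    then have "summable (\<lambda>j. norm (c k) * \<delta> / real (Suc j))"
      by (rule summable_comparison_test'[where N = N]) (use le \<delta> in auto)
    then have "summable (\<lambda>j. inverse (norm (c k) * \<delta>) * (norm (c k) * \<delta> / real (Suc j)))"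
      by (rule summable_mult)
    moreover have "inverse (norm (c k) * \<delta>) * (norm (c k) * \<delta> / real (Suc j)) = 1 / real (Suc j)" for j
      using k \<delta> by (simp add: field_simps)
    ultimately have "summable (\<lambda>j. 1 / real (Suc j))"
      by simp
    then show False
      using not_summable_harmonic[where 'a = real] summable_Suc_iff[of "\<lambda>n. 1 / real n"]
      by (simp add: inverse_eq_divide)
  qed
next
  assume "\<forall>k. c k = 0"
  then have "c = (\<lambda>k. 0)" by auto
  then show "\<forall>x\<in>l1_uncond scaleL2. (\<lambda>j. slab_mult c (x j)) \<in> l1_seq"
    by (simp add: l1_seq_def)
qed

section \<open>Prescribing the summing set\<close>

text \<open>
  The scalar field enters only as a normed field that is a Euclidean space, so the real and the
  complex case have one proof.
\<close>

lemma poly_with_summing_set: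
  fixes G :: "'k::{real_normed_field, euclidean_space} L2 set"
  assumes "n \<ge> 2" "fin_dim_subspace scaleL2 G"
  shows "\<exists>Q :: 'k L2 \<Rightarrow> 'k L1. cont_hom_poly scaleL2 scaleL1 n Q \<and> one_summing_set scaleL2 Q = G"
proof -
  obtain \<psi> :: "nat \<Rightarrow> 'k L2 \<Rightarrow> 'k" where dual: "\<And>k. \<psi> k \<in> dual_space scaleL2"
    and le: "\<And>k x. norm (\<psi> k x) \<le> (1/2) ^ k * norm x" and ker: "{x. \<forall>k. \<psi> k x = 0} = G"
    using fin_dim_subspace_common_kernel[OF assms(2)] by metis
  have le1: "norm (\<psi> k x) \<le> norm x" for k x
    by (rule order_trans[OF le half_power_mult_le]) simp
  define Q where "Q x = slab_mult (\<lambda>k. \<psi> k x ^ (n - 1)) x" for x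
  have "cont_hom_poly scaleL2 scaleL1 (Suc (n - 1)) Q"
    unfolding Q_def by (rule cont_hom_poly_slab_mult_power[OF dual le1])
  moreover have "one_summing_at scaleL2 Q a \<longleftrightarrow> a \<in> G" for a
  proof -
    have "bounded (range (\<lambda>k. \<psi> k a ^ (n - 1)))"
      unfolding bounded_iff
      by (intro exI[of _ "norm a ^ (n - 1)"]) (auto simp: norm_power power_mono le1)
    then have "one_summing_at scaleL2 Q a \<longleftrightarrow> (\<forall>k. \<psi> k a ^ (n - 1) = 0)"
      unfolding Q_def one_summing_at_slab_mult_power_iff[OF dual le] by (rule slab_mult_summing_iff)
    also have "\<dots> \<longleftrightarrow> a \<in> G"
      using assms(1) by (simp flip: ker)
    finally show ?thesis .
  qed
  ultimately show ?thesis
    using assms(1) by (intro exI[of _ Q]) (auto simp: one_summing_set_def)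
qed

theorem corollary4p11:
  shows "(\<forall>n\<ge>2. \<forall>G :: real L2 set. fin_dim_subspace scaleL2 G \<longrightarrow>
            (\<exists>Q :: real L2 \<Rightarrow> real L1.
               cont_hom_poly scaleL2 scaleL1 n Q \<and> one_summing_set scaleL2 Q = G))
       \<and> (\<forall>n\<ge>2. \<forall>G :: complex L2 set. fin_dim_subspace scaleL2 G \<longrightarrow>
            (\<exists>Q :: complex L2 \<Rightarrow> complex L1.
               cont_hom_poly scaleL2 scaleL1 n Q \<and> one_summing_set scaleL2 Q = G))"
  by (simp add: poly_with_summing_set)

end
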